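(* Let $B$ be the second Basilica group of the Grigorchuk--Erschler group. Then $B$ has the congruence subgroup property.
   Context: Let $T$ be the binary rooted tree with vertices the finite words over $X=\{0,1\}$ (root the empty word, each $v$ joined to $v0,v1$), and $\mathrm{Aut}\,T$ its group of root-fixing automorphisms, acting on the left. The section $g|_v$ of $g\in\mathrm{Aut}\,T$ at a vertex $v$ is defined by $g(vw)=g(v)g|_v(w)$. One writes $g=(g|_0,g|_1)\sigma$ with $\sigma\in\mathrm{Sym}(\{0,1\})$ the action on the first level; $(x,y)$ denotes the automorphism fixing $0,1$ with sections $x$ at $0$ and $y$ at $1$; $\tau$ is the transposition of $0$ and $1$. The second Basilica group $B$ of the Grigorchuk--Erschler group is the subgroup of $\mathrm{Aut}\,T$ generated by $a=(1,1)\tau$, $\alpha=(a,1)$, $c_0=(c_1,1)$, $c_1=(c_2,1)$, $c_2=(c_3,1)$, $c_3=(c_0,\alpha)$. $\mathrm{St}_G(n)$ is the subgroup of $G\le\mathrm{Aut}\,T$ of elements fixing every word of length $n$. $G$ has the congruence subgroup property if every subgroup of finite index in $G$ contains $\mathrm{St}_G(n)$ for some $n\in\mathbb{N}$. *)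

theory Defs
  imports "HOL-Algebra.Algebra"
begin

text \<open>
  The letters 0 and 1 are \<^term>\<open>False\<close> and \<^term>\<open>True\<close>; a word is read from the head of the list, so the
  head is the first letter below the root, and the children of \<open>v\<close> are \<open>v @ [x]\<close>.
\<close>

type_synonym word = "bool list"

definition tree_adj :: "word \<Rightarrow> word \<Rightarrow> bool" where
  "tree_adj u v \<longleftrightarrow> (\<exists>x. v = u @ [x] \<or> u = v @ [x])"

definition AutT :: "(word \<Rightarrow> word) monoid" where
  "AutT = \<lparr>carrier = {g. bij g \<and> g [] = [] \<and> (\<forall>u v. tree_adj (g u) (g v) \<longleftrightarrow> tree_adj u v)},
           monoid.mult = (\<circ>), one = id\<rparr>"

definition tree_section :: "(word \<Rightarrow> word) \<Rightarrow> word \<Rightarrow> word \<Rightarrow> word" where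
  "tree_section g v w = drop (length v) (g (v @ w))"

text \<open>
  \<open>wreath x y s\<close> is the map \<open>(x, y) s\<close> with sections \<open>x\<close> at 0 and \<open>y\<close> at 1, acting by \<open>s\<close> on the first level.
\<close>

fun wreath :: "(word \<Rightarrow> word) \<Rightarrow> (word \<Rightarrow> word) \<Rightarrow> (bool \<Rightarrow> bool) \<Rightarrow> word \<Rightarrow> word" where
  "wreath x y s [] = []"
| "wreath x y s (i # w) = s i # (if i then y else x) w"

definition gen_a :: "word \<Rightarrow> word" where
  "gen_a = wreath id id Not"

definition gen_alpha :: "word \<Rightarrow> word" where
  "gen_alpha = wreath gen_a id id"

text \<open>
  The generators \<open>c\<^sub>0, \<dots>, c\<^sub>3\<close> are defined letter by letter because their wreath recursion
  is circular; the lemma \<open>gen_c_wreath\<close> below recovers it.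
\<close>

fun gen_c0 gen_c1 gen_c2 gen_c3 :: "word \<Rightarrow> word" where
  "gen_c0 [] = []"
| "gen_c0 (i # w) = i # (if i then w else gen_c1 w)"
| "gen_c1 [] = []"
| "gen_c1 (i # w) = i # (if i then w else gen_c2 w)"
| "gen_c2 [] = []"
| "gen_c2 (i # w) = i # (if i then w else gen_c3 w)"
| "gen_c3 [] = []"
| "gen_c3 (i # w) = i # (if i then gen_alpha w else gen_c0 w)"

definition second_basilica :: "(word \<Rightarrow> word) set" where
  "second_basilica = generate AutT {gen_a, gen_alpha, gen_c0, gen_c1, gen_c2, gen_c3}"

definition level_stabilizer :: "(word \<Rightarrow> word) set \<Rightarrow> nat \<Rightarrow> (word \<Rightarrow> word) set" where
  "level_stabilizer G n = {g \<in> G. \<forall>w. length w = n \<longrightarrow> g w = w}"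

definition congruence_subgroup_property :: "(word \<Rightarrow> word) set \<Rightarrow> bool" where
  "congruence_subgroup_property G \<longleftrightarrow>
     (\<forall>H. subgroup H (AutT\<lparr>carrier := G\<rparr>) \<and> finite (rcosets\<^bsub>AutT\<lparr>carrier := G\<rparr>\<^esub> H)
          \<longrightarrow> (\<exists>n. level_stabilizer G n \<subseteq> H))"

lemma gen_c_wreath:
  "gen_c0 = wreath gen_c1 id id"
  "gen_c1 = wreath gen_c2 id id"
  "gen_c2 = wreath gen_c3 id id"
  "gen_c3 = wreath gen_c0 gen_alpha id"
proof -
  have "gen_c0 w = wreath gen_c1 id id w" "gen_c1 w = wreath gen_c2 id id w"
    "gen_c2 w = wreath gen_c3 id id w" "gen_c3 w = wreath gen_c0 gen_alpha id w" for w
    by (cases w; simp)+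
  then show "gen_c0 = wreath gen_c1 id id" "gen_c1 = wreath gen_c2 id id"
    "gen_c2 = wreath gen_c3 id id" "gen_c3 = wreath gen_c0 gen_alpha id"
    by (auto simp: fun_eq_iff)
qed

lemma tree_section_wreath:
  "tree_section (wreath x y s) [False] = x"
  "tree_section (wreath x y s) [True] = y"
  by (auto simp: tree_section_def fun_eq_iff)

lemma group_AutT: "group AutT"
proof (rule groupI)
  fix g assume g: "g \<in> carrier AutT"
  then have b: "bij g" "g [] = []" "\<And>u v. tree_adj (g u) (g v) \<longleftrightarrow> tree_adj u v"
    by (auto simp: AutT_def)
  have gi: "g (inv_into UNIV g u) = u" for u
    using b(1) by (simp add: bij_is_surj surj_f_inv_f)
  have "inv_into UNIV g \<in> carrier AutT"
    using b bij_imp_bij_inv[OF b(1)] inv_f_eq[OF bij_is_inj[OF b(1)] b(2)]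
    by (auto simp: AutT_def) (metis gi)+
  moreover have "inv_into UNIV g \<otimes>\<^bsub>AutT\<^esub> g = \<one>\<^bsub>AutT\<^esub>"
    using b(1) by (simp add: AutT_def bij_is_inj)
  ultimately show "\<exists>h\<in>carrier AutT. h \<otimes>\<^bsub>AutT\<^esub> g = \<one>\<^bsub>AutT\<^esub>" by blast
qed (auto simp: AutT_def bij_comp o_assoc)

lemma AutT_involutionI:
  assumes "\<And>w. g (g w) = w" "g [] = []" "\<And>w x. \<exists>y. g (w @ [x]) = g w @ [y]"
  shows "g \<in> carrier AutT"
proof -
  have *: "tree_adj (g u) (g v)" if "tree_adj u v" for u v
    using that assms(3) unfolding tree_adj_def by metis
  have "tree_adj (g u) (g v) \<longleftrightarrow> tree_adj u v" for u v
    using *[of u v] *[of "g u" "g v"] assms(1) by auto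
  moreover have "bij g" using assms(1) by (rule involuntory_imp_bij)
  ultimately show ?thesis using assms(2) by (simp add: AutT_def)
qed

lemma gens_in_AutT:
  "{gen_a, gen_alpha, gen_c0, gen_c1, gen_c2, gen_c3} \<subseteq> carrier AutT"
proof -
  have a: "gen_a (gen_a w) = w" "gen_a [] = []" "\<exists>y. gen_a (w @ [x]) = gen_a w @ [y]" for w x
    by (cases w; simp add: gen_a_def)+
  have al: "gen_alpha (gen_alpha w) = w" "gen_alpha [] = []"
    "\<exists>y. gen_alpha (w @ [x]) = gen_alpha w @ [y]" for w x
    using a by (cases w; simp add: gen_alpha_def)+
  have inv: "gen_c0 (gen_c0 w) = w \<and> gen_c1 (gen_c1 w) = w \<and> gen_c2 (gen_c2 w) = w \<and> gen_c3 (gen_c3 w) = w" for w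
    by (induction w) (auto simp: al)
  have sn: "(\<exists>y. gen_c0 (w @ [x]) = gen_c0 w @ [y]) \<and> (\<exists>y. gen_c1 (w @ [x]) = gen_c1 w @ [y]) \<and>
    (\<exists>y. gen_c2 (w @ [x]) = gen_c2 w @ [y]) \<and> (\<exists>y. gen_c3 (w @ [x]) = gen_c3 w @ [y])" for w x
    by (induction w) (auto simp: al)
  show ?thesis using a al inv sn by (auto intro!: AutT_involutionI)
qed

lemma subgroup_second_basilica: "subgroup second_basilica AutT"
  unfolding second_basilica_def
  by (rule group.generate_is_subgroup[OF group_AutT gens_in_AutT])

end

theory Submission imports Defs
begin

text \<open>
  Write \<open>[x, y]\<close> for the commutator \<open>x y x^-1 y^-1\<close>, \<open>B'\<close> for the derived subgroup of the group \<open>B\<close>,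
  \<open>St(n)\<close> for the stabilizer of level \<open>n\<close> in \<open>B\<close>, and \<open>R(N)\<close> for the set of all \<open>x\<close> with \<open>(x, 1) \<in> N\<close>.
  Since every element of \<open>B\<close> is the section at 0 of some element of \<open>B\<close> that fixes the first level,
  \<open>R(N)\<close> is normal in \<open>B\<close> whenever \<open>N\<close> is. Passing from \<open>N\<close> to \<open>R(N)\<close> loses one level:
  \<open>St(n) \<subseteq> R(N)\<close> implies \<open>St(n + 1) \<subseteq> N\<close>, because an element of \<open>St(n + 1)\<close> is a product
  \<open>(x, 1) (1, y)\<close> and conjugation by \<open>a\<close> exchanges the two coordinates. So it suffices to find, for a
  nontrivial normal subgroup \<open>N\<close>, an iterate of \<open>R\<close> at which \<open>N\<close> has grown to contain some \<open>St(n)\<close>.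

  The group is regular branch over \<open>B'\<close>, that is, \<open>B' \<subseteq> R(B')\<close>
  (\<open>derived_subset_coordinate_derived\<close>). Hence for \<open>k \<in> B'\<close> the copy \<open>k\<^sub>v\<close> of \<open>k\<close> acting below a
  vertex \<open>v\<close> lies in \<open>B\<close>. If \<open>g \<in> N\<close> moves \<open>v\<close>, then \<open>g k\<^sub>v g^-1\<close> and \<open>l\<^sub>v\<close> have disjoint supports, and so
  \<open>[[g, k\<^sub>v], l\<^sub>v] = [k\<^sub>v^-1, l\<^sub>v]\<close> (\<open>double_commutator_graft\<close>). Therefore \<open>[B', B']\<close> is contained in the
  iterate of \<open>R\<close> on \<open>N\<close> that belongs to the level of \<open>v\<close>.

  Three more applications of \<open>R\<close> finish the proof. If \<open>[B', B'] \<subseteq> M\<close>, then \<open>[B, B'] \<subseteq> R(R(M))\<close>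
  (\<open>derived_commutators_coordinate\<close>). If \<open>[B, B'] \<subseteq> M\<close>, then \<open>R(M)\<close> contains \<open>[a, c\<^sub>i]\<close> and
  \<open>[\<alpha>, c\<^sub>i]\<close> for \<open>i = 1, 2, 3\<close>, and \<open>[\<alpha> c\<^sub>0, a]\<close> (\<open>coordinate_commutators\<close>). Modulo these relations \<open>B\<close>
  has at most \<open>2\<^sup>7\<close> elements: each one equals
  \<open>a^e1 (\<alpha> a \<alpha>)^e2 \<alpha>^e3 c\<^sub>0^f0 c\<^sub>1^f1 c\<^sub>2^f2 c\<^sub>3^f3\<close> for some exponents 0 or 1. All seven exponents can be read off from the
  action on the first six levels (\<open>coset_normal_form\<close>), so they vanish on \<open>St(6)\<close>.

  A subgroup of finite index contains its normal core, and the core is nontrivial because \<open>B\<close> acts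
  transitively on every level and is therefore infinite.
\<close>

section \<open>Commutators modulo a normal subgroup\<close>

definition commutator :: "('a, 'b) monoid_scheme \<Rightarrow> 'a \<Rightarrow> 'a \<Rightarrow> 'a" where
  "commutator G x y = x \<otimes>\<^bsub>G\<^esub> y \<otimes>\<^bsub>G\<^esub> inv\<^bsub>G\<^esub> x \<otimes>\<^bsub>G\<^esub> inv\<^bsub>G\<^esub> y"

text \<open>
  This is the preimage of the centralizer of the image of \<open>M\<close> in \<open>G Mod N\<close>. Statements
  \<open>[H, M] \<subseteq> N\<close> become inclusions \<open>H \<subseteq> centralizer_mod G M N\<close>, which need to be checked on generators
  of \<open>H\<close> only.
\<close>

definition centralizer_mod :: "('a, 'b) monoid_scheme \<Rightarrow> 'a set \<Rightarrow> 'a set \<Rightarrow> 'a set" where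
  "centralizer_mod G M N = {g \<in> carrier G. \<forall>m \<in> M. commutator G g m \<in> N}"

context group
begin

lemma commutator_closed [simp, intro]:
  "x \<in> carrier G \<Longrightarrow> y \<in> carrier G \<Longrightarrow> commutator G x y \<in> carrier G"
  by (simp add: commutator_def)

text \<open>
  Membership of a commutator in \<open>N\<close> means that the two elements commute in the quotient, which is the
  form in which it is used for calculations.
\<close>

lemma commutator_mem_iff:
  assumes "N \<lhd> G" "x \<in> carrier G" "y \<in> carrier G"
  shows "commutator G x y \<in> N \<longleftrightarrow> N #> (x \<otimes> y) = N #> (y \<otimes> x)"
proof -
  interpret N: normal N G by fact
  have "commutator G x y = (x \<otimes> y) \<otimes> inv (y \<otimes> x)"
    using assms(2,3) by (simp add: commutator_def inv_mult_group m_assoc)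
  moreover have "(x \<otimes> y) \<otimes> inv (y \<otimes> x) \<in> N \<longleftrightarrow> x \<otimes> y \<in> N #> (y \<otimes> x)"
    using assms(2,3) by (intro N.rcos_module[symmetric]) (auto intro: is_group)
  moreover have "x \<otimes> y \<in> N #> (y \<otimes> x) \<longleftrightarrow> N #> (x \<otimes> y) = N #> (y \<otimes> x)"
    using assms(2,3) N.subgroup_axioms repr_independence rcos_self by (metis m_closed)
  ultimately show ?thesis by simp
qed

lemma commutator_mem_commute:
  assumes "N \<lhd> G" "x \<in> carrier G" "y \<in> carrier G" "commutator G x y \<in> N"
  shows "commutator G y x \<in> N"
  using assms by (simp add: commutator_mem_iff)

lemma centralizer_mod_subgroup:
  assumes N: "N \<lhd> G" and M: "M \<subseteq> carrier G"
  shows "subgroup (centralizer_mod G M N) G"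
proof -
  interpret N: normal N G by fact
  interpret Q: group "G Mod N" by (rule N.factorgroup_is_group)
  interpret p: group_hom G "G Mod N" "\<lambda>x. N #> x"
    by (rule group_hom.intro) (auto simp: is_group Q.is_group group_hom_axioms_def N.r_coset_hom_Mod)
  have iff: "commutator G g m \<in> N \<longleftrightarrow>
      (N #> g) \<otimes>\<^bsub>G Mod N\<^esub> (N #> m) = (N #> m) \<otimes>\<^bsub>G Mod N\<^esub> (N #> g)"
    if "g \<in> carrier G" "m \<in> carrier G" for g m
    using that N by (simp only: commutator_mem_iff flip: p.hom_mult)
  have "subgroup {g \<in> carrier G. commutator G g m \<in> N} G" if m: "m \<in> carrier G" for m
  proof (rule subgroupI)
    show "{g \<in> carrier G. commutator G g m \<in> N} \<noteq> {}"
      using m by (auto intro!: exI[of _ \<one>] simp: commutator_def)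
  next
    fix g assume "g \<in> {g \<in> carrier G. commutator G g m \<in> N}"
    then have g: "g \<in> carrier G" "commutator G g m \<in> N" by auto
    have "(N #> inv g) = inv\<^bsub>G Mod N\<^esub> (N #> g)" using g by (intro p.hom_inv)
    then have "commutator G (inv g) m \<in> N"
      using iff[of g m] iff[of "inv g" m] g m
      by (smt (verit) Q.inv_closed Q.inv_solve_right Q.m_assoc inv_closed p.hom_closed Q.m_closed Q.inv_solve_left)
    with g show "inv g \<in> {g \<in> carrier G. commutator G g m \<in> N}" by simp
  next
    fix g h assume "g \<in> {g \<in> carrier G. commutator G g m \<in> N}" "h \<in> {g \<in> carrier G. commutator G g m \<in> N}"
    then have g: "g \<in> carrier G" "commutator G g m \<in> N" and h: "h \<in> carrier G" "commutator G h m \<in> N" by auto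
    have "N #> (g \<otimes> h) = (N #> g) \<otimes>\<^bsub>G Mod N\<^esub> (N #> h)" using g h by (intro p.hom_mult)
    then have "commutator G (g \<otimes> h) m \<in> N"
      using iff[of g m] iff[of h m] iff[of "g \<otimes> h" m] g h m
      by (smt (verit) Q.m_assoc m_closed p.hom_closed)
    with g h show "g \<otimes> h \<in> {g \<in> carrier G. commutator G g m \<in> N}" by simp
  qed auto
  moreover have "centralizer_mod G M N = (\<Inter>m\<in>M. {g \<in> carrier G. commutator G g m \<in> N})" if "M \<noteq> {}"
    using that by (auto simp: centralizer_mod_def)
  moreover have "centralizer_mod G {} N = carrier G" by (simp add: centralizer_mod_def)
  ultimately show ?thesis
    using M by (cases "M = {}") (auto intro!: subgroups_Inter simp: subgroup_self)
qed

lemma centralizer_mod_normal: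
  assumes N: "N \<lhd> G" and M: "M \<lhd> G"
  shows "centralizer_mod G M N \<lhd> G"
proof (rule normal_invI)
  interpret N: normal N G by fact
  interpret M: normal M G by fact
  show "subgroup (centralizer_mod G M N) G"
    using N M.subset by (rule centralizer_mod_subgroup)
  fix x g assume x: "x \<in> carrier G" and g: "g \<in> centralizer_mod G M N"
  then have gc: "g \<in> carrier G" by (simp add: centralizer_mod_def)
  have "commutator G (x \<otimes> g \<otimes> inv x) m \<in> N" if m: "m \<in> M" for m
  proof -
    have mc: "m \<in> carrier G" using m by (rule M.mem_carrier)
    have "inv x \<otimes> m \<otimes> x \<in> M" using x m by (rule M.inv_op_closed1)
    then have "x \<otimes> commutator G g (inv x \<otimes> m \<otimes> x) \<otimes> inv x \<in> N"
      using g x by (intro N.inv_op_closed2) (auto simp: centralizer_mod_def)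
    also have "x \<otimes> commutator G g (inv x \<otimes> m \<otimes> x) \<otimes> inv x = commutator G (x \<otimes> g \<otimes> inv x) m"
      using x gc mc by (simp add: commutator_def inv_mult_group m_assoc inv_solve_left')
    finally show ?thesis .
  qed
  then show "x \<otimes> g \<otimes> inv x \<in> centralizer_mod G M N"
    using x gc by (simp add: centralizer_mod_def)
qed

lemma generator_set_subset_subgroup:
  assumes "generate G S = carrier G" "subgroup H G" "S \<subseteq> H"
  shows "carrier G \<subseteq> H"
  using generate_subgroup_incl[OF assms(3,2)] assms(1) by simp

text \<open>
  The quotient by \<open>N\<close> is generated by commuting elements, so it is abelian. Applying the subgroup
  property of centralizers twice replaces first one and then the other generator by an arbitrary element.
\<close>

lemma derived_subset_normal:
  assumes N: "N \<lhd> G" and S: "generate G S = carrier G"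
    and comm: "\<And>s t. s \<in> S \<Longrightarrow> t \<in> S \<Longrightarrow> commutator G s t \<in> N"
  shows "derived G (carrier G) \<subseteq> N"
proof -
  have Sc: "S \<subseteq> carrier G" using S by (auto intro: generate.incl)
  have "S \<subseteq> centralizer_mod G S N"
    using Sc comm by (auto simp: centralizer_mod_def)
  then have *: "carrier G \<subseteq> centralizer_mod G S N"
    using generator_set_subset_subgroup[OF S centralizer_mod_subgroup[OF N Sc]] by simp
  have "S \<subseteq> centralizer_mod G (carrier G) N"
    using * Sc N by (fastforce simp: centralizer_mod_def intro: commutator_mem_commute)
  then have "carrier G \<subseteq> centralizer_mod G (carrier G) N"
    using generator_set_subset_subgroup[OF S centralizer_mod_subgroup[OF N]] by simp
  then have "derived_set G (carrier G) \<subseteq> N"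
    by (auto simp: centralizer_mod_def commutator_def)
  then show ?thesis
    unfolding derived_def using generate_subgroup_incl normal_imp_subgroup[OF N] by blast
qed

lemma commutator_mem_normal:
  assumes N: "N \<lhd> G" and "x \<in> N" "y \<in> carrier G"
  shows "commutator G x y \<in> N" "commutator G y x \<in> N"
proof -
  interpret N: normal N G by fact
  have x: "x \<in> carrier G" using assms(2) by (rule N.mem_carrier)
  have "x \<otimes> (y \<otimes> inv x \<otimes> inv y) \<in> N"
    using assms by (intro N.m_closed N.inv_op_closed2 N.m_inv_closed)
  then show "commutator G x y \<in> N" using x assms(3) by (simp add: commutator_def m_assoc)
  then show "commutator G y x \<in> N" using N x assms(3) by (intro commutator_mem_commute[of N x y])
qed

lemma commutator_mem_derived:
  assumes "x \<in> H" "y \<in> H"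
  shows "commutator G x y \<in> derived G H"
  using assms unfolding derived_def commutator_def by (intro generate.incl) auto

end

text \<open>
  The normal core \<open>N\<close> is the kernel of the action on the cosets of \<open>H\<close>. If it were trivial, then the
  group would embed into the finite set of maps from the cosets to the cosets.
\<close>

lemma (in group) finite_index_normal_core:
  assumes H: "subgroup H G" and fin: "finite (rcosets H)" and inf: "infinite (carrier G)"
  shows "\<exists>N. N \<lhd> G \<and> N \<subseteq> H \<and> N \<noteq> {\<one>}"
proof -
  interpret H: subgroup H G by fact
  define N where "N = {g \<in> carrier G. \<forall>x\<in>carrier G. x \<otimes> g \<otimes> inv x \<in> H}"
  have N: "N \<lhd> G"
  proof (rule normal_invI)
    show "subgroup N G"
    proof (rule subgroupI)
      show "N \<noteq> {}" by (auto simp: N_def intro!: exI[of _ \<one>])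
    next
      fix g assume g: "g \<in> N"
      have "x \<otimes> inv g \<otimes> inv x \<in> H" if x: "x \<in> carrier G" for x
      proof -
        have "inv (x \<otimes> g \<otimes> inv x) \<in> H" using g x by (intro H.m_inv_closed) (simp add: N_def)
        then show ?thesis using g x by (simp add: N_def inv_mult_group m_assoc)
      qed
      then show "inv g \<in> N" using g by (simp add: N_def)
    next
      fix g h assume gh: "g \<in> N" "h \<in> N"
      have "x \<otimes> (g \<otimes> h) \<otimes> inv x \<in> H" if x: "x \<in> carrier G" for x
      proof -
        have "(x \<otimes> g \<otimes> inv x) \<otimes> (x \<otimes> h \<otimes> inv x) \<in> H" 
          by (rule H.m_closed) (use gh x in \<open>simp_all add: N_def\<close>)
        also have "(x \<otimes> g \<otimes> inv x) \<otimes> (x \<otimes> h \<otimes> inv x) = x \<otimes> (g \<otimes> h) \<otimes> inv x"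
        proof -
          have "inv x \<otimes> (x \<otimes> (h \<otimes> inv x)) = h \<otimes> inv x"
            using gh x by (simp add: N_def flip: m_assoc)
          then show ?thesis using gh x by (simp add: N_def m_assoc)
        qed
        finally show ?thesis .
      qed
      then show "g \<otimes> h \<in> N" using gh by (simp add: N_def)
    qed (auto simp: N_def)
  next
    fix y g assume y: "y \<in> carrier G" and g: "g \<in> N"
    have "x \<otimes> (y \<otimes> g \<otimes> inv y) \<otimes> inv x \<in> H" if x: "x \<in> carrier G" for x
    proof -
      have "(x \<otimes> y) \<otimes> g \<otimes> inv (x \<otimes> y) \<in> H" using x y g by (simp add: N_def)
      then show ?thesis using x y g by (simp add: N_def inv_mult_group m_assoc)
    qed
    then show "y \<otimes> g \<otimes> inv y \<in> N" using y g by (simp add: N_def)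
  qed
  have "N \<subseteq> H"
  proof
    fix g assume "g \<in> N"
    then have "\<one> \<otimes> g \<otimes> inv \<one> \<in> H" "g \<in> carrier G" unfolding N_def by blast+
    then show "g \<in> H" by simp
  qed
  moreover have "N \<noteq> {\<one>}"
  proof
    assume triv: "N = {\<one>}"
    let ?f = "\<lambda>g. \<lambda>C\<in>rcosets H. C #> g"
    have "inj_on ?f (carrier G)"
    proof (rule inj_onI)
      fix g h assume g: "g \<in> carrier G" and h: "h \<in> carrier G" and eq: "?f g = ?f h"
      have "x \<otimes> (g \<otimes> inv h) \<otimes> inv x \<in> H" if x: "x \<in> carrier G" for x
      proof -
        have "H #> x \<in> rcosets H" using x by (simp add: rcosetsI H.subset)
        then have "(H #> x) #> g = (H #> x) #> h" using fun_cong[OF eq, of "H #> x"] by simp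
        then have "H #> (x \<otimes> g) = H #> (x \<otimes> h)" using x g h by (simp add: coset_mult_assoc H.subset)
        then have "x \<otimes> g \<in> H #> (x \<otimes> h)" using x g by (metis rcos_self H m_closed)
        then have "(x \<otimes> g) \<otimes> inv (x \<otimes> h) \<in> H" using x g h by (subst (asm) H.rcos_module) (auto intro: is_group)
        then show ?thesis using x g h by (simp add: inv_mult_group m_assoc)
      qed
      then have "g \<otimes> inv h \<in> N" using g h by (simp add: N_def)
      then have "g \<otimes> inv h = \<one>" using triv by simp
      then show "g = h" using g h by (metis inv_equality inv_inv inv_closed)
    qed
    moreover have "?f ` carrier G \<subseteq> (rcosets H) \<rightarrow>\<^sub>E (rcosets H)"
    proof -
      have "C #> g \<in> rcosets H" if "C \<in> rcosets H" "g \<in> carrier G" for C g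
        using that by (auto simp: RCOSETS_def coset_mult_assoc H.subset)
      then show ?thesis by auto
    qed
    then have "finite (?f ` carrier G)" using fin by (metis finite_PiE finite_subset)
    ultimately show False using inf finite_imageD by blast
  qed
  ultimately show ?thesis using N by blast
qed

section \<open>Sections and generators of the second Basilica group\<close>

abbreviation Basilica :: "(word \<Rightarrow> word) monoid" where
  "Basilica \<equiv> AutT\<lparr>carrier := second_basilica\<rparr>"

abbreviation generators :: "(word \<Rightarrow> word) set" where
  "generators \<equiv> {gen_a, gen_alpha, gen_c0, gen_c1, gen_c2, gen_c3}"

lemma wreath_Nil_Cons_eqI:
  "f [] = g [] \<Longrightarrow> (\<And>i w. f (i # w) = g (i # w)) \<Longrightarrow> f = g"
  by (rule ext) (metis list.exhaust)

lemma wreath_comp: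
  "wreath x y s \<circ> wreath u v id = wreath (x \<circ> u) (y \<circ> v) s"
  "wreath x y s \<circ> wreath u v Not = wreath (y \<circ> u) (x \<circ> v) (s \<circ> Not)"
  by (rule wreath_Nil_Cons_eqI; simp)+

lemma Not_comp_Not: "Not \<circ> Not = id" by auto

lemma wreath_id: "wreath id id id = id"
  by (rule wreath_Nil_Cons_eqI; simp)

lemma wreath_eq_iff: "wreath x y s = wreath u v t \<longleftrightarrow> x = u \<and> y = v \<and> s = t"
proof
  assume *: "wreath x y s = wreath u v t"
  have "s i # (if i then y else x) w = t i # (if i then v else u) w" for i w
    using fun_cong[OF *, of "i # w"] by simp
  then have "s i = t i" "(if i then y else x) w = (if i then v else u) w" for i w by simp_all
  from this(1) this(2)[of False] this(2)[of True] show "x = u \<and> y = v \<and> s = t" by auto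
qed simp

lemma generators_involutive:
  "gen_a \<circ> gen_a = id" "gen_alpha \<circ> gen_alpha = id"
  "gen_c0 \<circ> gen_c0 = id" "gen_c1 \<circ> gen_c1 = id" "gen_c2 \<circ> gen_c2 = id" "gen_c3 \<circ> gen_c3 = id"
proof -
  show a: "gen_a \<circ> gen_a = id" by (simp add: gen_a_def wreath_comp Not_comp_Not wreath_id)
  then show al: "gen_alpha \<circ> gen_alpha = id"
    by (simp add: gen_alpha_def wreath_comp wreath_id)
  have "gen_c0 (gen_c0 w) = w \<and> gen_c1 (gen_c1 w) = w \<and> gen_c2 (gen_c2 w) = w \<and> gen_c3 (gen_c3 w) = w" for w
    using fun_cong[OF al] by (induction w) auto
  then show "gen_c0 \<circ> gen_c0 = id" "gen_c1 \<circ> gen_c1 = id" "gen_c2 \<circ> gen_c2 = id" "gen_c3 \<circ> gen_c3 = id"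
    by auto
qed

lemma generators_c_commute:
  assumes "x \<in> {gen_c0, gen_c1, gen_c2, gen_c3}" "y \<in> {gen_c0, gen_c1, gen_c2, gen_c3}"
  shows "x \<circ> y = y \<circ> x"
proof -
  have "gen_c0 (gen_c1 w) = gen_c1 (gen_c0 w) \<and> gen_c0 (gen_c2 w) = gen_c2 (gen_c0 w) \<and>
     gen_c0 (gen_c3 w) = gen_c3 (gen_c0 w) \<and> gen_c1 (gen_c2 w) = gen_c2 (gen_c1 w) \<and>
     gen_c1 (gen_c3 w) = gen_c3 (gen_c1 w) \<and> gen_c2 (gen_c3 w) = gen_c3 (gen_c2 w)" for w
    by (induction w) auto
  then show ?thesis using assms by (elim insertE emptyE) (simp_all add: fun_eq_iff)
qed

lemma AutT_simps [simp]: "x \<otimes>\<^bsub>AutT\<^esub> y = x \<circ> y" "\<one>\<^bsub>AutT\<^esub> = id"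
  by (simp_all add: AutT_def)

lemma Basilica_mult: "x \<otimes>\<^bsub>Basilica\<^esub> y = x \<circ> y"
  by simp

lemma group_Basilica: "group Basilica"
  by (rule subgroup.subgroup_is_group[OF subgroup_second_basilica group_AutT])

interpretation Basilica: group Basilica
  rewrites "carrier Basilica = second_basilica" and "x \<otimes>\<^bsub>Basilica\<^esub> y = x \<circ> y" and "\<one>\<^bsub>Basilica\<^esub> = id"
  by (rule group_Basilica) (auto simp: AutT_def)

lemma generators_in_Basilica:
  "gen_a \<in> second_basilica" "gen_alpha \<in> second_basilica" "gen_c0 \<in> second_basilica"
  "gen_c1 \<in> second_basilica" "gen_c2 \<in> second_basilica" "gen_c3 \<in> second_basilica"
  by (auto simp: second_basilica_def intro: generate.incl)

lemma generators_subset: "generators \<subseteq> second_basilica"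
  using generators_in_Basilica by blast

lemma generate_Basilica: "generate Basilica generators = second_basilica"
  using group.generate_consistent[OF group_AutT _ subgroup_second_basilica, of generators] generators_in_Basilica
  by (simp add: second_basilica_def)

lemma bij_Basilica: "g \<in> second_basilica \<Longrightarrow> bij g"
  using subgroup.subset[OF subgroup_second_basilica] by (auto simp: AutT_def)

lemma inv_Basilica:
  assumes "g \<in> second_basilica"
  shows "inv\<^bsub>Basilica\<^esub> g = inv_into UNIV g"
proof -
  have "inv\<^bsub>Basilica\<^esub> g = inv\<^bsub>Basilica\<^esub> g \<circ> (g \<circ> inv_into UNIV g)"
    using bij_Basilica[OF assms] by (simp add: surj_iff[THEN iffD1] bij_is_surj)
  also have "\<dots> = inv_into UNIV g"
    unfolding o_assoc Basilica.l_inv[OF assms] by simp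
  finally show ?thesis .
qed

lemma inv_generators:
  "x \<in> generators \<Longrightarrow> inv\<^bsub>Basilica\<^esub> x = x"
  using generators_in_Basilica generators_involutive by (intro Basilica.inv_equality) auto

text \<open>
  As the generators are involutions, every element is a product of generators without inverses. New
  letters are added on the left, the side on which they act last.
\<close>

lemma Basilica_induct [consumes 1, case_names id mult]:
  assumes "g \<in> second_basilica" "P id"
    and mult: "\<And>x g. x \<in> generators \<Longrightarrow> g \<in> second_basilica \<Longrightarrow> P g \<Longrightarrow> P (x \<circ> g)"
  shows "P g"
proof -
  have "h \<in> second_basilica \<Longrightarrow> P h \<Longrightarrow> P (g \<circ> h)" if "g \<in> generate Basilica generators" for h
    using that
  proof (induction arbitrary: h)
    case one
    then show ?case by simp
  next
    case (incl x)
    then show ?case using mult by blast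
  next
    case (inv x)
    then show ?case using mult[of x h] by (simp only: inv_generators)
  next
    case (eng g1 g2)
    have g2: "g2 \<in> second_basilica" using eng.hyps(2) by (simp only: generate_Basilica)
    have "P (g1 \<circ> (g2 \<circ> h))"
      by (rule eng.IH(1)[OF Basilica.m_closed[OF g2 eng.prems(1)] eng.IH(2)[OF eng.prems]])
    then show ?case by (simp only: Basilica_mult o_assoc)
  qed
  from this[of id] show ?thesis using assms(1,2) generate_Basilica by simp
qed

lemma generators_wreath:
  assumes "g \<in> generators"
  shows "\<exists>x y s. g = wreath x y s \<and> x \<in> second_basilica \<and> y \<in> second_basilica \<and> (s = id \<or> s = Not)"
proof -
  have *: ?thesis if "g = wreath x y s" "x \<in> second_basilica" "y \<in> second_basilica" "s = id \<or> s = Not" for x y s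
    using that by blast
  note B = generators_in_Basilica Basilica.one_closed
  from assms show ?thesis
  proof (elim insertE emptyE)
    assume "g = gen_a"
    then show ?thesis using B by (intro *[of id id Not]) (auto simp: gen_a_def)
  next
    assume "g = gen_alpha"
    then show ?thesis using B by (intro *[of gen_a id id]) (auto simp: gen_alpha_def)
  next
    assume "g = gen_c0"
    then show ?thesis using B by (intro *[of gen_c1 id id]) (auto simp: gen_c_wreath(1))
  next
    assume "g = gen_c1"
    then show ?thesis using B by (intro *[of gen_c2 id id]) (auto simp: gen_c_wreath(2))
  next
    assume "g = gen_c2"
    then show ?thesis using B by (intro *[of gen_c3 id id]) (auto simp: gen_c_wreath(3))
  next
    assume "g = gen_c3"
    then show ?thesis using B by (intro *[of gen_c0 gen_alpha id]) (auto simp: gen_c_wreath(4))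
  qed
qed

lemma Basilica_wreath:
  assumes "g \<in> second_basilica"
  obtains x y s where "g = wreath x y s" "x \<in> second_basilica" "y \<in> second_basilica" "s = id \<or> s = Not"
proof -
  have "\<exists>x y s. g = wreath x y s \<and> x \<in> second_basilica \<and> y \<in> second_basilica \<and> (s = id \<or> s = Not)"
    using assms
  proof (induction rule: Basilica_induct)
    case id
    then show ?case using wreath_id[symmetric] Basilica.one_closed by blast
  next
    case (mult x g)
    from generators_wreath[OF mult(1)] obtain u v s where x: "x = wreath u v s" "u \<in> second_basilica" "v \<in> second_basilica"
      "s = id \<or> s = Not" by blast
    from mult(3) obtain p q t where g: "g = wreath p q t" "p \<in> second_basilica" "q \<in> second_basilica"
      "t = id \<or> t = Not" by blast
    show ?case
    proof (cases "t = id")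
      case True
      have "x \<circ> g = wreath (u \<circ> p) (v \<circ> q) s" unfolding x g True by (rule wreath_comp)
      then show ?thesis using Basilica.m_closed[OF x(2) g(2)] Basilica.m_closed[OF x(3) g(3)] x(4) by blast
    next
      case False
      then have t: "t = Not" using g(4) by blast
      have "x \<circ> g = wreath (v \<circ> p) (u \<circ> q) (s \<circ> Not)" unfolding x g t by (rule wreath_comp)
      moreover have "s \<circ> Not = id \<or> s \<circ> Not = Not" using x(4) Not_comp_Not by auto
      ultimately show ?thesis using Basilica.m_closed[OF x(3) g(2)] Basilica.m_closed[OF x(2) g(3)] by blast
    qed
  qed
  with that show ?thesis by blast
qed

lemma Basilica_sections:
  assumes "wreath x y s \<in> second_basilica"
  shows "x \<in> second_basilica" "y \<in> second_basilica"
  using Basilica_wreath[OF assms] by (metis wreath_eq_iff)+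

lemma a_conj_wreath: "gen_a \<circ> wreath x y id \<circ> gen_a = wreath y x id"
  by (simp add: gen_a_def wreath_comp Not_comp_Not)

lemma conj_gen_c3: "gen_a \<circ> gen_c3 \<circ> gen_a = wreath gen_alpha gen_c0 id"
  by (simp add: gen_c_wreath(4) a_conj_wreath)

lemma level_one_elements:
  "wreath gen_a id id \<in> second_basilica" "wreath gen_alpha gen_c0 id \<in> second_basilica"
  "wreath gen_c0 gen_alpha id \<in> second_basilica" "wreath gen_c1 id id \<in> second_basilica"
  "wreath gen_c2 id id \<in> second_basilica" "wreath gen_c3 id id \<in> second_basilica"
  unfolding gen_c_wreath[symmetric] gen_alpha_def[symmetric] conj_gen_c3[symmetric]
  using generators_in_Basilica by (auto intro!: Basilica.m_closed)

text \<open>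
  Each generator is the first section of an element of the group that fixes the first level:
  \<open>a\<close> and \<open>c\<^sub>0, \<dots>, c\<^sub>3\<close> occur in \<open>\<alpha>\<close>, \<open>c\<^sub>3\<close>, \<open>c\<^sub>0\<close>, \<open>c\<^sub>1\<close>, \<open>c\<^sub>2\<close>, and \<open>\<alpha>\<close> occurs in the conjugate
  \<open>a c\<^sub>3 a = (\<alpha>, c\<^sub>0)\<close>.
\<close>

lemma Basilica_self_replicating:
  assumes "x \<in> second_basilica"
  shows "\<exists>y. wreath x y id \<in> second_basilica"
  using assms
proof (induction rule: Basilica_induct)
  case id
  then show ?case using wreath_id Basilica.one_closed by metis
next
  case (mult x g)
  have "\<exists>y. wreath x y id \<in> second_basilica"
    using mult(1) level_one_elements by (elim insertE emptyE) blast+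
  then obtain y where y: "wreath x y id \<in> second_basilica" by blast
  from mult(3) obtain z where z: "wreath g z id \<in> second_basilica" by blast
  have "wreath (x \<circ> g) (y \<circ> z) id \<in> second_basilica"
    using Basilica.m_closed[OF y z] by (simp add: wreath_comp)
  then show ?case by blast
qed

lemma inv_wreath:
  assumes "bij x" "bij y"
  shows "inv_into UNIV (wreath x y id) = wreath (inv_into UNIV x) (inv_into UNIV y) id"
proof (rule inv_unique_comp)
  have "x \<circ> inv_into UNIV x = id" "y \<circ> inv_into UNIV y = id"
    using assms[THEN bij_is_surj] by (simp_all only: surj_iff)
  then show "wreath x y id \<circ> wreath (inv_into UNIV x) (inv_into UNIV y) id = id"
    by (simp only: wreath_comp wreath_id)
  have "inv_into UNIV x \<circ> x = id" "inv_into UNIV y \<circ> y = id"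
    using assms[THEN bij_is_inj] by (simp_all only: inj_iff)
  then show "wreath (inv_into UNIV x) (inv_into UNIV y) id \<circ> wreath x y id = id"
    by (simp only: wreath_comp wreath_id)
qed

lemma commutator_Basilica:
  "g \<in> second_basilica \<Longrightarrow> h \<in> second_basilica \<Longrightarrow>
    commutator Basilica g h = g \<circ> h \<circ> inv_into UNIV g \<circ> inv_into UNIV h"
  by (simp only: commutator_def inv_Basilica Basilica_mult)

lemma commutator_wreath:
  assumes "wreath x y id \<in> second_basilica" "wreath u v id \<in> second_basilica"
  shows "commutator Basilica (wreath x y id) (wreath u v id) =
    wreath (commutator Basilica x u) (commutator Basilica y v) id"
  using assms Basilica_sections[OF assms(1)] Basilica_sections[OF assms(2)]
  by (simp only: commutator_Basilica inv_wreath bij_Basilica wreath_comp)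

lemma commutator_generators:
  "g \<in> generators \<Longrightarrow> h \<in> generators \<Longrightarrow> commutator Basilica g h = g \<circ> h \<circ> g \<circ> h"
  by (simp only: inv_generators commutator_def Basilica_mult)

lemma level_stabilizer_Suc:
  assumes "g \<in> level_stabilizer second_basilica (Suc n)"
  obtains x y where "g = wreath x y id" "x \<in> level_stabilizer second_basilica n" "y \<in> level_stabilizer second_basilica n"
proof -
  have gB: "g \<in> second_basilica" and fix_words: "\<And>w. length w = Suc n \<Longrightarrow> g w = w"
    using assms by (auto simp: level_stabilizer_def)
  obtain x y s where g: "g = wreath x y s" "x \<in> second_basilica" "y \<in> second_basilica" "s = id \<or> s = Not"
    using Basilica_wreath[OF gB] .
  have fixes': "s i = i" "(if i then y else x) w = w" if "length w = n" for i w
    using fix_words[of "i # w"] that g(1) by auto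
  have "s False = False" using fixes'(1)[of "replicate n False"] by simp
  then have "s = id" using g(4) by auto
  moreover have "x \<in> level_stabilizer second_basilica n" "y \<in> level_stabilizer second_basilica n"
    using fixes'(2)[of _ False] fixes'(2)[of _ True] g by (auto simp: level_stabilizer_def)
  ultimately show ?thesis using that g(1) by blast
qed

section \<open>The coordinate subgroups of a normal subgroup\<close>

abbreviation basilica_derived :: "(word \<Rightarrow> word) set" where
  "basilica_derived \<equiv> derived Basilica second_basilica"

definition coordinate_subgroup :: "(word \<Rightarrow> word) set \<Rightarrow> (word \<Rightarrow> word) set" where
  "coordinate_subgroup N = {x. wreath x id id \<in> N}"

lemma coordinate_subgroup_mono: "M \<subseteq> N \<Longrightarrow> coordinate_subgroup M \<subseteq> coordinate_subgroup N"
  by (auto simp: coordinate_subgroup_def)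

lemma coordinate_subgroup_subset:
  "N \<subseteq> second_basilica \<Longrightarrow> coordinate_subgroup N \<subseteq> second_basilica"
  by (auto simp: coordinate_subgroup_def dest: Basilica_sections(1))

lemma normal_subset: "N \<lhd> Basilica \<Longrightarrow> N \<subseteq> second_basilica"
  using subgroup.subset[OF normal_imp_subgroup] by fastforce

text \<open>
  Conjugating \<open>(h, 1)\<close> by \<open>(x, y)\<close> gives \<open>(x h x^-1, 1)\<close>; a suitable \<open>y\<close> exists for every \<open>x\<close> by
  self-replication.
\<close>

lemma coordinate_subgroup_normal:
  assumes N: "N \<lhd> Basilica"
  shows "coordinate_subgroup N \<lhd> Basilica"
proof (rule Basilica.normal_invI)
  have sub: "coordinate_subgroup N \<subseteq> second_basilica"
    by (intro coordinate_subgroup_subset normal_subset N)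
  have id_inv: "inv_into UNIV id = (id :: word \<Rightarrow> word)" by simp
  note Ns = normal_imp_subgroup[OF N]
  show "subgroup (coordinate_subgroup N) Basilica"
  proof (rule Basilica.subgroupI[OF sub])
    show "coordinate_subgroup N \<noteq> {}"
      using subgroup.one_closed[OF Ns] by (auto simp: coordinate_subgroup_def wreath_id intro!: exI[of _ id])
  next
    fix x assume x: "x \<in> coordinate_subgroup N"
    then have xB: "x \<in> second_basilica" "wreath x id id \<in> N" "wreath x id id \<in> second_basilica"
      using sub normal_subset[OF N] by (auto simp: coordinate_subgroup_def)
    then have "inv\<^bsub>Basilica\<^esub> wreath x id id = wreath (inv\<^bsub>Basilica\<^esub> x) id id"
      by (simp only: inv_Basilica inv_wreath bij_Basilica bij_id id_inv)
    with xB subgroup.m_inv_closed[OF Ns] show "inv\<^bsub>Basilica\<^esub> x \<in> coordinate_subgroup N"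
      by (metis coordinate_subgroup_def mem_Collect_eq)
  next
    fix x y assume "x \<in> coordinate_subgroup N" "y \<in> coordinate_subgroup N"
    then show "x \<circ> y \<in> coordinate_subgroup N"
      using subgroup.m_closed[OF Ns, of "wreath x id id" "wreath y id id"]
      by (simp add: coordinate_subgroup_def wreath_comp)
  qed
next
  fix x h assume x: "x \<in> second_basilica" and h: "h \<in> coordinate_subgroup N"
  obtain y where xy: "wreath x y id \<in> second_basilica"
    using Basilica_self_replicating[OF x] by blast
  then have y: "y \<in> second_basilica" by (rule Basilica_sections)
  have "wreath x y id \<circ> wreath h id id \<circ> inv\<^bsub>Basilica\<^esub> (wreath x y id) \<in> N"
    using Basilica.normal_invE(2)[OF N xy] h by (simp add: coordinate_subgroup_def)
  also have "wreath x y id \<circ> wreath h id id \<circ> inv\<^bsub>Basilica\<^esub> (wreath x y id) =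
      wreath (x \<circ> h \<circ> inv\<^bsub>Basilica\<^esub> x) (y \<circ> id \<circ> inv\<^bsub>Basilica\<^esub> y) id"
    by (simp only: inv_Basilica[OF x] inv_Basilica[OF y] inv_Basilica[OF xy]
        inv_wreath[OF bij_Basilica[OF x] bij_Basilica[OF y]] wreath_comp)
  also have "y \<circ> id \<circ> inv\<^bsub>Basilica\<^esub> y = id"
    using Basilica.r_inv[OF y] by (simp only: comp_id)
  finally show "x \<circ> h \<circ> inv\<^bsub>Basilica\<^esub> x \<in> coordinate_subgroup N"
    by (simp only: coordinate_subgroup_def mem_Collect_eq)
qed

lemma second_coordinate_mem_iff:
  assumes N: "N \<lhd> Basilica"
  shows "wreath id x id \<in> N \<longleftrightarrow> x \<in> coordinate_subgroup N"
proof -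
  have "gen_a \<circ> n \<circ> gen_a \<in> N" if "n \<in> N" for n
    using Basilica.normal_invE(2)[OF N generators_in_Basilica(1) that] inv_generators[of gen_a] by simp
  from this[of "wreath x id id"] this[of "wreath id x id"] show ?thesis
    by (auto simp: a_conj_wreath coordinate_subgroup_def)
qed

lemma commutator_eq_id:
  assumes "x \<in> second_basilica" "y \<in> second_basilica" "x \<circ> y = y \<circ> x"
  shows "commutator Basilica x y = id"
proof -
  have "commutator Basilica x y = (x \<circ> y) \<circ> (inv\<^bsub>Basilica\<^esub> x \<circ> inv\<^bsub>Basilica\<^esub> y)"
    by (simp only: commutator_def Basilica_mult o_assoc)
  also have "inv\<^bsub>Basilica\<^esub> x \<circ> inv\<^bsub>Basilica\<^esub> y = inv\<^bsub>Basilica\<^esub> (y \<circ> x)"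
    using Basilica.inv_mult_group[OF assms(2,1)] by simp
  also have "(x \<circ> y) \<circ> inv\<^bsub>Basilica\<^esub> (y \<circ> x) = id"
    unfolding assms(3) using Basilica.r_inv[OF Basilica.m_closed[OF assms(2,1)]] .
  finally show ?thesis .
qed

text \<open>
  The source of elements of the form \<open>(z, 1)\<close>: in a commutator of two pairs the second coordinate
  disappears as soon as the second coordinates commute.
\<close>

lemma commutator_coordinateI:
  assumes "commutator Basilica (wreath x y id) (wreath u v id) \<in> N"
    and "wreath x y id \<in> second_basilica" "wreath u v id \<in> second_basilica" "y \<circ> v = v \<circ> y"
  shows "commutator Basilica x u \<in> coordinate_subgroup N"
proof -
  have "commutator Basilica y v = id"
    by (rule commutator_eq_id[OF Basilica_sections(2)[OF assms(2)] Basilica_sections(2)[OF assms(3)] assms(4)])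
  then show ?thesis using assms(1) by (simp add: commutator_wreath[OF assms(2,3)] coordinate_subgroup_def)
qed

lemma commutator_a_wreath:
  assumes "g \<in> generators" "g = wreath x y id"
  shows "commutator Basilica gen_a g = wreath (y \<circ> x) (x \<circ> y) id"
proof -
  have "commutator Basilica gen_a g = gen_a \<circ> wreath x y id \<circ> gen_a \<circ> wreath x y id"
    using assms commutator_generators[of gen_a g] by simp
  then show ?thesis by (simp only: a_conj_wreath wreath_comp)
qed

lemma commutators_with_a:
  "commutator Basilica gen_a gen_alpha = wreath gen_a gen_a id"
  "commutator Basilica gen_a gen_c0 = wreath gen_c1 gen_c1 id"
  "commutator Basilica gen_a gen_c1 = wreath gen_c2 gen_c2 id"
  "commutator Basilica gen_a gen_c2 = wreath gen_c3 gen_c3 id"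
  "commutator Basilica gen_a gen_c3 = wreath (gen_alpha \<circ> gen_c0) (gen_c0 \<circ> gen_alpha) id"
proof -
  show "commutator Basilica gen_a gen_alpha = wreath gen_a gen_a id"
    by (subst commutator_a_wreath[OF _ gen_alpha_def]) (blast, simp only: comp_id id_comp)
  show "commutator Basilica gen_a gen_c0 = wreath gen_c1 gen_c1 id"
    by (subst commutator_a_wreath[OF _ gen_c_wreath(1)]) (blast, simp only: comp_id id_comp)
  show "commutator Basilica gen_a gen_c1 = wreath gen_c2 gen_c2 id"
    by (subst commutator_a_wreath[OF _ gen_c_wreath(2)]) (blast, simp only: comp_id id_comp)
  show "commutator Basilica gen_a gen_c2 = wreath gen_c3 gen_c3 id"
    by (subst commutator_a_wreath[OF _ gen_c_wreath(3)]) (blast, simp only: comp_id id_comp)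
  show "commutator Basilica gen_a gen_c3 = wreath (gen_alpha \<circ> gen_c0) (gen_c0 \<circ> gen_alpha) id"
    by (subst commutator_a_wreath[OF _ gen_c_wreath(4)]) (blast, simp only:)
qed

lemma derived_Basilica_subset:
  assumes N: "N \<lhd> Basilica"
    and "commutator Basilica gen_a gen_alpha \<in> N"
    and "\<And>c. c \<in> {gen_c0, gen_c1, gen_c2, gen_c3} \<Longrightarrow> commutator Basilica gen_a c \<in> N"
    and "\<And>c. c \<in> {gen_c0, gen_c1, gen_c2, gen_c3} \<Longrightarrow> commutator Basilica gen_alpha c \<in> N"
  shows "basilica_derived \<subseteq> N"
proof (rule Basilica.derived_subset_normal[OF N generate_Basilica])
  let ?C = "{gen_c0, gen_c1, gen_c2, gen_c3}"
  fix s t assume st: "s \<in> generators" "t \<in> generators"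
  have id: "id \<in> N" using subgroup.one_closed[OF normal_imp_subgroup[OF N]] by simp
  have sym: "commutator Basilica x y \<in> N"
    if "commutator Basilica y x \<in> N" "x \<in> generators" "y \<in> generators" for x y
    by (rule Basilica.commutator_mem_commute[OF N _ _ that(1)])
      (rule subsetD[OF generators_subset], fact)+
  have commuting: "commutator Basilica x y \<in> N"
    if "x \<in> generators" "y \<in> generators" "x \<circ> y = y \<circ> x" for x y
    using commutator_eq_id[OF subsetD[OF generators_subset that(1)] subsetD[OF generators_subset that(2)] that(3)] id
    by simp
  have self: "commutator Basilica x x \<in> N" if "x \<in> generators" for x
    using that that refl by (rule commuting)
  have CC: "commutator Basilica x y \<in> N" if "x \<in> ?C" "y \<in> ?C" for x y
    by (rule commuting[OF _ _ generators_c_commute[OF that]]) (use that in blast)+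
  have cases: "x = gen_a \<or> x = gen_alpha \<or> x \<in> ?C" if "x \<in> generators" for x
    using that by blast
  from cases[OF st(1)] cases[OF st(2)] show "commutator Basilica s t \<in> N"
  proof (elim disjE)
    assume "s = gen_a" "t = gen_a"
    then show ?thesis using self[OF st(1)] by (simp only:)
  next
    assume "s = gen_a" "t = gen_alpha"
    then show ?thesis using assms(2) by (simp only:)
  next
    assume "s = gen_a" "t \<in> ?C"
    then show ?thesis using assms(3) by (simp only:)
  next
    assume "s = gen_alpha" "t = gen_a"
    then show ?thesis using sym[OF _ st] assms(2) by (simp only:)
  next
    assume "s = gen_alpha" "t = gen_alpha"
    then show ?thesis using self[OF st(1)] by (simp only:)
  next
    assume "s = gen_alpha" "t \<in> ?C"
    then show ?thesis using assms(4) by (simp only:)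
  next
    assume "s \<in> ?C" "t = gen_a"
    then show ?thesis using sym[OF _ st] assms(3)[of s] by (simp only:)
  next
    assume "s \<in> ?C" "t = gen_alpha"
    then show ?thesis using sym[OF _ st] assms(4)[of s] by (simp only:)
  next
    assume "s \<in> ?C" "t \<in> ?C"
    then show ?thesis by (rule CC)
  qed
qed

lemma derived_normal: "basilica_derived \<lhd> Basilica"
  by (rule Basilica.derived_self_is_normal)

lemma commutator_in_derived:
  "x \<in> second_basilica \<Longrightarrow> y \<in> second_basilica \<Longrightarrow> commutator Basilica x y \<in> basilica_derived"
  by (rule Basilica.commutator_mem_derived)

text \<open>
  An element of \<open>St(n + 1)\<close> is \<open>(x, 1) (1, y)\<close> with \<open>x, y \<in> St(n)\<close>, and both factors lie in \<open>N\<close>.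
\<close>

lemma level_stabilizer_coordinate:
  assumes N: "N \<lhd> Basilica" and sub: "level_stabilizer second_basilica n \<subseteq> coordinate_subgroup N"
  shows "level_stabilizer second_basilica (Suc n) \<subseteq> N"
proof
  fix g assume "g \<in> level_stabilizer second_basilica (Suc n)"
  then obtain x y where g: "g = wreath x y id" "x \<in> coordinate_subgroup N" "y \<in> coordinate_subgroup N"
    using sub level_stabilizer_Suc by (metis subsetD)
  have "wreath x id id \<circ> wreath id y id \<in> N"
    using subgroup.m_closed[OF normal_imp_subgroup[OF N], of "wreath x id id" "wreath id y id"] g(2,3)
      second_coordinate_mem_iff[OF N, of y] by (simp add: coordinate_subgroup_def)
  then show "g \<in> N" unfolding g(1) wreath_comp comp_id id_comp .
qed

lemma coordinate_power_normal:
  "N \<lhd> Basilica \<Longrightarrow> (coordinate_subgroup ^^ n) N \<lhd> Basilica"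
  by (induction n) (auto intro: coordinate_subgroup_normal)

lemma level_stabilizer_coordinate_power:
  assumes "N \<lhd> Basilica" "level_stabilizer second_basilica m \<subseteq> (coordinate_subgroup ^^ n) N"
  shows "level_stabilizer second_basilica (n + m) \<subseteq> N"
  using assms
proof (induction n arbitrary: N)
  case (Suc n)
  have "level_stabilizer second_basilica m \<subseteq> (coordinate_subgroup ^^ n) (coordinate_subgroup N)"
    using Suc.prems(2) by (simp only: funpow_Suc_right o_apply)
  then have "level_stabilizer second_basilica (n + m) \<subseteq> coordinate_subgroup N"
    by (rule Suc.IH[OF coordinate_subgroup_normal[OF Suc.prems(1)]])
  then show ?case
    using level_stabilizer_coordinate[OF Suc.prems(1)] by simp
qed simp

section \<open>Branching over the derived subgroup\<close>

text \<open>
  The elements \<open>[a, \<alpha>] = (a, a)\<close>, \<open>[a, c\<^sub>i] = (c\<^sub>i\<^sub>+\<^sub>1, c\<^sub>i\<^sub>+\<^sub>1)\<close> for \<open>i < 3\<close> and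
  \<open>[a, c\<^sub>3] = (\<alpha> c\<^sub>0, c\<^sub>0 \<alpha>)\<close> belong to the derived subgroup. The three families arise by taking their
  commutators with \<open>c\<^sub>0, c\<^sub>1, c\<^sub>2\<close>, with \<open>(\<alpha>, c\<^sub>0)\<close>, and with \<open>\<alpha> = (a, 1)\<close>; in each case the second
  coordinates commute.
\<close>

lemma coordinate_commutators:
  assumes N: "N \<lhd> Basilica"
    and NN: "\<And>m g. m \<in> basilica_derived \<Longrightarrow> g \<in> second_basilica \<Longrightarrow> commutator Basilica m g \<in> N"
  shows "c \<in> {gen_c1, gen_c2, gen_c3} \<Longrightarrow> commutator Basilica gen_a c \<in> coordinate_subgroup N"
    and "c \<in> {gen_c1, gen_c2, gen_c3} \<Longrightarrow> commutator Basilica gen_alpha c \<in> coordinate_subgroup N"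
    and "commutator Basilica (gen_alpha \<circ> gen_c0) gen_a \<in> coordinate_subgroup N"
proof -
  note B = generators_in_Basilica
  have D: "wreath gen_a gen_a id \<in> basilica_derived" "wreath gen_c1 gen_c1 id \<in> basilica_derived"
    "wreath gen_c2 gen_c2 id \<in> basilica_derived" "wreath gen_c3 gen_c3 id \<in> basilica_derived"
    "wreath (gen_alpha \<circ> gen_c0) (gen_c0 \<circ> gen_alpha) id \<in> basilica_derived"
    unfolding commutators_with_a[symmetric] by (intro commutator_in_derived B)+
  have comm: "commutator Basilica x u \<in> coordinate_subgroup N"
    if "wreath x y id \<in> basilica_derived" "wreath u v id \<in> second_basilica" "y \<circ> v = v \<circ> y" for x y u v
    by (rule commutator_coordinateI[OF NN[OF that(1,2)] subsetD[OF normal_subset[OF derived_normal] that(1)] that(2,3)])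
  have id: "x \<circ> id = id \<circ> x" for x :: "word \<Rightarrow> word" by simp
  show "commutator Basilica gen_a c \<in> coordinate_subgroup N" if "c \<in> {gen_c1, gen_c2, gen_c3}"
    using that comm[OF D(1) level_one_elements(4) id] comm[OF D(1) level_one_elements(5) id]
      comm[OF D(1) level_one_elements(6) id] by blast
  have c0: "gen_c1 \<circ> gen_c0 = gen_c0 \<circ> gen_c1" "gen_c2 \<circ> gen_c0 = gen_c0 \<circ> gen_c2" "gen_c3 \<circ> gen_c0 = gen_c0 \<circ> gen_c3"
    by (rule generators_c_commute; blast)+
  have "commutator Basilica c gen_alpha \<in> coordinate_subgroup N" if "c \<in> {gen_c1, gen_c2, gen_c3}"
    using that comm[OF D(2) level_one_elements(2) c0(1)] comm[OF D(3) level_one_elements(2) c0(2)]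
      comm[OF D(4) level_one_elements(2) c0(3)] by blast
  then show "commutator Basilica gen_alpha c \<in> coordinate_subgroup N" if "c \<in> {gen_c1, gen_c2, gen_c3}"
    using that B(4-6) Basilica.commutator_mem_commute[OF coordinate_subgroup_normal[OF N] _ B(2)] by blast
  show "commutator Basilica (gen_alpha \<circ> gen_c0) gen_a \<in> coordinate_subgroup N"
    by (rule comm[OF D(5) level_one_elements(1) id])
qed

text \<open>
  Both sides equal \<open>([a, c\<^sub>1], 1)\<close>. Consequently a normal subgroup that contains \<open>[a, \<alpha>]\<close> contains \<open>[\<alpha>, c\<^sub>0]\<close>,
  and so does one modulo which \<open>[a, \<alpha>]\<close> commutes with \<open>c\<^sub>0\<close>.
\<close>

lemma commutator_a_alpha_c0:
  "commutator Basilica (commutator Basilica gen_a gen_alpha) gen_c0 = commutator Basilica gen_alpha gen_c0"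
proof -
  have id: "commutator Basilica x id = id" if "x \<in> second_basilica" for x
    by (rule commutator_eq_id[OF that Basilica.one_closed]) simp
  have aa: "wreath gen_a gen_a id \<in> second_basilica"
    unfolding commutators_with_a(1)[symmetric] by (intro Basilica.commutator_closed generators_in_Basilica)
  have "commutator Basilica (wreath gen_a gen_a id) (wreath gen_c1 id id) =
     commutator Basilica (wreath gen_a id id) (wreath gen_c1 id id)"
    unfolding commutator_wreath[OF aa level_one_elements(4)] commutator_wreath[OF level_one_elements(1,4)]
      id[OF generators_in_Basilica(1)] id[OF Basilica.one_closed] ..
  then show ?thesis
    by (simp only: commutators_with_a(1) gen_c_wreath(1)[symmetric] gen_alpha_def[symmetric])
qed

text \<open>
  The coordinate subgroup is normal, so it is enough that it contains the commutators of the generators.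
  Most of them come from the previous calculations; \<open>[a, c\<^sub>0]\<close> comes from \<open>[\<alpha>, c\<^sub>3]\<close>, where the
  second coordinates \<open>1\<close> and \<open>\<alpha>\<close> commute. From \<open>[\<alpha> c\<^sub>0, a]\<close> and \<open>[c\<^sub>0, a]\<close> one gets \<open>[\<alpha>, a]\<close>, and then
  \<open>[\<alpha>, c\<^sub>0] = [[a, \<alpha>], c\<^sub>0]\<close>.
\<close>

lemma derived_subset_coordinate_derived: "basilica_derived \<subseteq> coordinate_subgroup basilica_derived"
proof -
  let ?K = "coordinate_subgroup basilica_derived"
  note B = generators_in_Basilica
  have K: "?K \<lhd> Basilica" by (intro coordinate_subgroup_normal derived_normal)
  note rels = coordinate_commutators[OF derived_normal commutator_in_derived[OF subsetD[OF normal_subset[OF derived_normal]]]]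
  have c0: "commutator Basilica gen_a gen_c0 \<in> ?K"
    by (rule commutator_coordinateI[OF commutator_in_derived[OF level_one_elements(1,3)] level_one_elements(1,3)]) simp
  let ?Z = "centralizer_mod Basilica {gen_a} ?K"
  have Z: "subgroup ?Z Basilica"
    by (rule Basilica.centralizer_mod_subgroup[OF K]) (use B(1) in simp)
  have "commutator Basilica gen_c0 gen_a \<in> ?K"
    by (rule Basilica.commutator_mem_commute[OF K B(1) B(3) c0])
  then have "gen_c0 \<in> ?Z" "gen_alpha \<circ> gen_c0 \<in> ?Z"
    using rels(3) B(2,3) Basilica.m_closed[OF B(2,3)] by (simp_all add: centralizer_mod_def)
  \<comment> \<open>The product of \<open>\<alpha> c\<^sub>0\<close> and \<open>c\<^sub>0\<close> isolates \<open>\<alpha>\<close>.\<close>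
  from subgroup.m_closed[OF Z this(2,1)] have "(gen_alpha \<circ> gen_c0) \<circ> gen_c0 \<in> ?Z" by simp
  also have "(gen_alpha \<circ> gen_c0) \<circ> gen_c0 = gen_alpha"
    unfolding comp_assoc generators_involutive by simp
  finally have "commutator Basilica gen_alpha gen_a \<in> ?K" by (simp add: centralizer_mod_def)
  then have al: "commutator Basilica gen_a gen_alpha \<in> ?K"
    by (rule Basilica.commutator_mem_commute[OF K B(2,1)])
  have "commutator Basilica gen_alpha gen_c0 \<in> ?K"
    unfolding commutator_a_alpha_c0[symmetric]
    by (rule Basilica.commutator_mem_normal(1)[OF K al B(3)])
  with c0 al rels show ?thesis
    by (intro derived_Basilica_subset[OF K]) blast+
qed

section \<open>From commutators of the derived subgroup to commutators with the whole group\<close>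

lemma centralizer_derivedI:
  assumes "x \<in> second_basilica" "\<And>m. m \<in> basilica_derived \<Longrightarrow> commutator Basilica x m \<in> N"
  shows "x \<in> centralizer_mod Basilica basilica_derived N"
  using assms by (simp add: centralizer_mod_def)

text \<open>
  For \<open>m\<close> in the derived subgroup, \<open>(m, 1)\<close> is again in the derived subgroup by branching, and
  \<open>[(x, y), (m, 1)] = ([x, m], 1)\<close>.
\<close>

lemma centralizer_coordinate:
  assumes xy: "wreath x y id \<in> centralizer_mod Basilica basilica_derived N"
  shows "x \<in> centralizer_mod Basilica basilica_derived (coordinate_subgroup N)"
proof (rule centralizer_derivedI)
  have xyB: "wreath x y id \<in> second_basilica" using xy by (simp add: centralizer_mod_def)
  then show "x \<in> second_basilica" by (rule Basilica_sections)
  fix m assume "m \<in> basilica_derived"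
  then have m: "wreath m id id \<in> basilica_derived"
    using derived_subset_coordinate_derived by (auto simp: coordinate_subgroup_def)
  show "commutator Basilica x m \<in> coordinate_subgroup N"
  proof (rule commutator_coordinateI[OF _ xyB])
    show "wreath m id id \<in> second_basilica" using m normal_subset[OF derived_normal] by blast
    show "commutator Basilica (wreath x y id) (wreath m id id) \<in> N"
      using xy m by (simp add: centralizer_mod_def)
  qed simp
qed

text \<open>
  Let \<open>Z(N)\<close> be the centralizer of \<open>B'\<close> modulo \<open>N\<close>. The first coordinates of elements of \<open>Z(N)\<close> lie in
  \<open>Z(R(N))\<close>. Taking first coordinates of elements of \<open>B' \<subseteq> Z(N)\<close> shows that \<open>Z(R(N))\<close> contains
  \<open>a, c\<^sub>1, c\<^sub>2, c\<^sub>3, \<alpha> c\<^sub>0\<close>. It is normal, so it also contains \<open>(\<alpha>, c\<^sub>0)\<close> and \<open>[a, \<alpha>] = (a, a)\<close>, and a second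
  passage to first coordinates reaches all generators.
\<close>

lemma derived_commutators_coordinate:
  assumes N: "N \<lhd> Basilica"
    and NN: "\<And>k m. k \<in> basilica_derived \<Longrightarrow> m \<in> basilica_derived \<Longrightarrow> commutator Basilica k m \<in> N"
  shows "second_basilica \<subseteq> centralizer_mod Basilica basilica_derived (coordinate_subgroup (coordinate_subgroup N))"
proof -
  let ?Z = "\<lambda>N. centralizer_mod Basilica basilica_derived N"
  let ?M = "coordinate_subgroup N"
  note B = generators_in_Basilica
  have M: "?M \<lhd> Basilica" by (rule coordinate_subgroup_normal[OF N])
  have ZM: "?Z ?M \<lhd> Basilica" by (rule Basilica.centralizer_mod_normal[OF M derived_normal])
  have "basilica_derived \<subseteq> ?Z N"
    using NN normal_subset[OF derived_normal] by (blast intro: centralizer_derivedI)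
  moreover have "wreath gen_a gen_a id \<in> basilica_derived" "wreath gen_c1 gen_c1 id \<in> basilica_derived"
    "wreath gen_c2 gen_c2 id \<in> basilica_derived" "wreath gen_c3 gen_c3 id \<in> basilica_derived"
    "wreath (gen_alpha \<circ> gen_c0) (gen_c0 \<circ> gen_alpha) id \<in> basilica_derived"
    unfolding commutators_with_a[symmetric] by (intro commutator_in_derived B)+
  ultimately have "gen_a \<in> ?Z ?M" "gen_c1 \<in> ?Z ?M" "gen_c2 \<in> ?Z ?M" "gen_c3 \<in> ?Z ?M" "gen_alpha \<circ> gen_c0 \<in> ?Z ?M"
    by (blast intro: centralizer_coordinate)+
  note Z1 = this
  have conj: "x \<circ> z \<circ> x \<in> ?Z ?M" if "x \<in> generators" "z \<in> ?Z ?M" for x z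
    using Basilica.normal_invE(2)[OF ZM subsetD[OF generators_subset that(1)] that(2)] inv_generators[OF that(1)]
    by simp
  have "gen_a \<circ> gen_c3 \<circ> gen_a \<in> ?Z ?M" by (rule conj) (use Z1 in blast)+
  then have d: "wreath gen_alpha gen_c0 id \<in> ?Z ?M" by (simp only: conj_gen_c3)
  have "commutator Basilica gen_a gen_alpha \<in> ?Z ?M"
    by (rule Basilica.commutator_mem_normal(1)[OF ZM Z1(1) B(2)])
  then have aa: "wreath gen_a gen_a id \<in> ?Z ?M" by (simp only: commutators_with_a)
  have "gen_alpha \<circ> gen_c0 = wreath (gen_a \<circ> gen_c1) id id"
    by (simp only: gen_alpha_def gen_c_wreath(1) wreath_comp comp_id)
  with Z1(5) have ac: "wreath (gen_a \<circ> gen_c1) id id \<in> ?Z ?M" by (simp only:)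
  have c: "wreath gen_c2 id id \<in> ?Z ?M" "wreath gen_c3 id id \<in> ?Z ?M" "wreath gen_c0 gen_alpha id \<in> ?Z ?M"
    using Z1(2-4) by (simp_all only: gen_c_wreath(2,3,4)[symmetric])
  let ?Z2 = "?Z (coordinate_subgroup ?M)"
  have Z2: "gen_alpha \<in> ?Z2" "gen_a \<in> ?Z2" "gen_a \<circ> gen_c1 \<in> ?Z2" "gen_c2 \<in> ?Z2" "gen_c3 \<in> ?Z2" "gen_c0 \<in> ?Z2"
    using d aa ac c by (blast intro: centralizer_coordinate)+
  have sub: "subgroup ?Z2 Basilica"
    by (rule Basilica.centralizer_mod_subgroup[OF coordinate_subgroup_normal[OF M] normal_subset[OF derived_normal]])
  \<comment> \<open>The element \<open>\<alpha> c\<^sub>0 = (a c\<^sub>1, 1)\<close> supplies only \<open>a c\<^sub>1\<close>, but \<open>a\<close> has been reached separately.\<close>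
  from subgroup.m_closed[OF sub Z2(2,3)] have "gen_a \<circ> (gen_a \<circ> gen_c1) \<in> ?Z2" by simp
  then have "gen_c1 \<in> ?Z2" by (simp only: o_assoc generators_involutive id_comp)
  with Z2 have "generators \<subseteq> ?Z2" by blast
  then show ?thesis by (rule Basilica.generator_set_subset_subgroup[OF generate_Basilica sub])
qed

section \<open>Parities of the action on the levels\<close>

text \<open>
  The parity of the number of vertices of level \<open>n\<close> at which \<open>g\<close> exchanges the two children.
\<close>

fun level_sign :: "nat \<Rightarrow> (word \<Rightarrow> word) \<Rightarrow> bool" where
  "level_sign 0 g \<longleftrightarrow> g [False] = [True]"
| "level_sign (Suc n) g \<longleftrightarrow> level_sign n (tree_section g [False]) \<noteq> level_sign n (tree_section g [True])"

lemma level_sign_Suc_wreath [simp]: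
  "level_sign (Suc n) (wreath x y s) \<longleftrightarrow> level_sign n x \<noteq> level_sign n y"
  by (simp add: tree_section_wreath)

lemma Basilica_Nil: "g \<in> second_basilica \<Longrightarrow> g [] = []"
  using subgroup.subset[OF subgroup_second_basilica] by (auto simp: AutT_def)

text \<open>
  The section of \<open>g h\<close> at \<open>v\<close> is the section of \<open>g\<close> at \<open>h(v)\<close> times the section of \<open>h\<close> at \<open>v\<close>, and \<open>h\<close>
  permutes the vertices of each level.
\<close>

lemma level_sign_comp:
  "g \<in> second_basilica \<Longrightarrow> h \<in> second_basilica \<Longrightarrow>
    level_sign n (g \<circ> h) \<longleftrightarrow> level_sign n g \<noteq> level_sign n h"
proof (induction n arbitrary: g h)
  case 0
  obtain x y s where g: "g = wreath x y s" "x \<in> second_basilica" "y \<in> second_basilica" "s = id \<or> s = Not"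
    using Basilica_wreath[OF 0(1)] .
  obtain u v t where h: "h = wreath u v t" "u \<in> second_basilica" "v \<in> second_basilica" "t = id \<or> t = Not"
    using Basilica_wreath[OF 0(2)] .
  show ?case using g h by (auto simp: Basilica_Nil)
next
  case (Suc n)
  obtain x y s where g: "g = wreath x y s" "x \<in> second_basilica" "y \<in> second_basilica" "s = id \<or> s = Not"
    using Basilica_wreath[OF Suc(2)] .
  obtain u v t where h: "h = wreath u v t" "u \<in> second_basilica" "v \<in> second_basilica" "t = id \<or> t = Not"
    using Basilica_wreath[OF Suc(3)] .
  from h(4) show ?case
  proof
    assume t: "t = id"
    show ?thesis unfolding g(1) h(1) t wreath_comp level_sign_Suc_wreath
      using Suc.IH[OF g(2) h(2)] Suc.IH[OF g(3) h(3)] by blast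
  next
    assume t: "t = Not"
    show ?thesis unfolding g(1) h(1) t wreath_comp level_sign_Suc_wreath
      using Suc.IH[OF g(3) h(2)] Suc.IH[OF g(2) h(3)] by blast
  qed
qed

text \<open>
  The parities of the levels separate the generators, but they are trivial on commutators. Applied to the
  section at 0, this combination also detects \<open>[a, \<alpha>] = (a, a)\<close> and \<open>[a, c\<^sub>0] = (c\<^sub>1, c\<^sub>1)\<close>, and it vanishes
  on the relators \<open>[a, c\<^sub>i]\<close>, \<open>[\<alpha>, c\<^sub>i]\<close> for \<open>i = 1, 2, 3\<close> and \<open>[\<alpha> c\<^sub>0, a]\<close>.
\<close>

definition split_sign :: "(word \<Rightarrow> word) \<Rightarrow> bool" where
  "split_sign g \<longleftrightarrow> level_sign 0 g \<noteq> level_sign 4 g"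

text \<open>
  Because the section at 0 of \<open>x g\<close> uses the section of \<open>x\<close> at \<open>g(0)\<close>, this quantity is not additive, but a
  cocycle that depends on the action of \<open>g\<close> on the first level.
\<close>

lemma split_sign_section_comp:
  assumes "wreath p q s \<in> second_basilica" "g \<in> second_basilica"
  shows "split_sign (tree_section (wreath p q s \<circ> g) [False]) \<longleftrightarrow>
    split_sign (if level_sign 0 g then q else p) \<noteq> split_sign (tree_section g [False])"
proof -
  have comp: "split_sign (x \<circ> y) \<longleftrightarrow> split_sign x \<noteq> split_sign y"
    if "x \<in> second_basilica" "y \<in> second_basilica" for x y
    unfolding split_sign_def level_sign_comp[OF that] by blast
  obtain u v t where h: "g = wreath u v t" "u \<in> second_basilica" "v \<in> second_basilica" "t = id \<or> t = Not"
    using Basilica_wreath[OF assms(2)] .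
  note pq = Basilica_sections[OF assms(1)]
  from h(4) show ?thesis
  proof
    assume t: "t = id"
    have "\<not> level_sign 0 g" unfolding h t using h(2) by (simp add: Basilica_Nil)
    then show ?thesis unfolding h(1) t wreath_comp tree_section_wreath using comp[OF pq(1) h(2)] by simp
  next
    assume t: "t = Not"
    have "level_sign 0 g" unfolding h t using h(2) by (simp add: Basilica_Nil)
    then show ?thesis unfolding h(1) t wreath_comp tree_section_wreath using comp[OF pq(2) h(2)] by simp
  qed
qed

text \<open>
  The numbers 5, 4, 3, 2 are the depths at which the recursion of \<open>c\<^sub>0, c\<^sub>1, c\<^sub>2, c\<^sub>3\<close> first reaches the section
  \<open>a\<close>. Further sections \<open>a\<close> follow with period 4, which is why the last four claims stop at level 5.
\<close>

lemma level_sign_generators: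
  "\<not> level_sign n id"
  "level_sign n gen_a \<longleftrightarrow> n = 0"
  "level_sign n gen_alpha \<longleftrightarrow> n = 1"
  "n \<le> 5 \<Longrightarrow> level_sign n gen_c0 \<longleftrightarrow> n = 5"
  "n \<le> 5 \<Longrightarrow> level_sign n gen_c1 \<longleftrightarrow> n = 4"
  "n \<le> 5 \<Longrightarrow> level_sign n gen_c2 \<longleftrightarrow> n = 3"
  "n \<le> 5 \<Longrightarrow> level_sign n gen_c3 \<longleftrightarrow> n = 2"
proof -
  show id: "\<not> level_sign n id" for n
  proof (induction n)
    case (Suc n)
    show ?case using level_sign_Suc_wreath[of n id id id, unfolded wreath_id] by blast
  qed simp
  have Nil: "gen_c0 [] = []" "gen_c1 [] = []" "gen_c2 [] = []" "gen_c3 [] = []" by simp_all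
  show a: "level_sign n gen_a \<longleftrightarrow> n = 0" for n
    using id by (cases n) (auto simp: gen_a_def level_sign_Suc_wreath simp del: level_sign.simps(2))
  show al: "level_sign n gen_alpha \<longleftrightarrow> n = 1" for n
    using id a by (cases n) (auto simp: gen_alpha_def level_sign_Suc_wreath simp del: level_sign.simps(2))
  have c0: "level_sign 0 gen_c0 \<longleftrightarrow> False" "level_sign (Suc n) gen_c0 \<longleftrightarrow> level_sign n gen_c1"
    and c1: "level_sign 0 gen_c1 \<longleftrightarrow> False" "level_sign (Suc n) gen_c1 \<longleftrightarrow> level_sign n gen_c2"
    and c2: "level_sign 0 gen_c2 \<longleftrightarrow> False" "level_sign (Suc n) gen_c2 \<longleftrightarrow> level_sign n gen_c3"
    and c3: "level_sign 0 gen_c3 \<longleftrightarrow> False" "level_sign (Suc n) gen_c3 \<longleftrightarrow> level_sign n gen_c0 \<noteq> (n = 1)" for n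
    using id[of n] al[of n] level_sign_Suc_wreath[of n gen_c1 id id, folded gen_c_wreath(1)]
      level_sign_Suc_wreath[of n gen_c2 id id, folded gen_c_wreath(2)]
      level_sign_Suc_wreath[of n gen_c3 id id, folded gen_c_wreath(3)]
      level_sign_Suc_wreath[of n gen_c0 gen_alpha id, folded gen_c_wreath(4)]
    by (simp, blast, simp, blast, simp, blast, simp, blast)
  note c = c0 c1 c2 c3
  { fix P :: "nat \<Rightarrow> bool" assume "P 0" "P 1" "P 2" "P 3" "P 4" "P 5" and n: "n \<le> 5"
    then have "P n" by (auto simp: le_Suc_eq numeral_eq_Suc) }
  note six = this
  show "level_sign n gen_c0 \<longleftrightarrow> n = 5" "level_sign n gen_c1 \<longleftrightarrow> n = 4" 
   "level_sign n gen_c2 \<longleftrightarrow> n = 3" "level_sign n gen_c3 \<longleftrightarrow> n = 2" if n: "n \<le> 5"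
    by (rule six[OF _ _ _ _ _ _ n]; simp add: c numeral_eq_Suc del: level_sign.simps)+
qed

lemma split_sign_generators_comp:
  assumes g: "g \<in> second_basilica"
  shows "split_sign (tree_section (gen_a \<circ> g) [False]) \<longleftrightarrow> split_sign (tree_section g [False])"
    "split_sign (tree_section (gen_alpha \<circ> g) [False]) \<longleftrightarrow> level_sign 0 g = split_sign (tree_section g [False])"
    "split_sign (tree_section (gen_c0 \<circ> g) [False]) \<longleftrightarrow> level_sign 0 g = split_sign (tree_section g [False])"
    "split_sign (tree_section (gen_c1 \<circ> g) [False]) \<longleftrightarrow> split_sign (tree_section g [False])"
    "split_sign (tree_section (gen_c2 \<circ> g) [False]) \<longleftrightarrow> split_sign (tree_section g [False])"
    "split_sign (tree_section (gen_c3 \<circ> g) [False]) \<longleftrightarrow> split_sign (tree_section g [False])"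
proof -
  have v: "\<not> split_sign id" "split_sign gen_a" "\<not> split_sign gen_alpha" "\<not> split_sign gen_c0"
    "split_sign gen_c1" "\<not> split_sign gen_c2" "\<not> split_sign gen_c3"
    by (simp_all only: split_sign_def level_sign_generators) simp_all
  note c = split_sign_section_comp[OF _ g]
  note B = generators_in_Basilica
  show "split_sign (tree_section (gen_a \<circ> g) [False]) \<longleftrightarrow> split_sign (tree_section g [False])"
    using c[of id id Not] v B(1) unfolding gen_a_def by auto
  show "split_sign (tree_section (gen_alpha \<circ> g) [False]) \<longleftrightarrow> level_sign 0 g = split_sign (tree_section g [False])"
    using c[OF level_one_elements(1)] v unfolding gen_alpha_def[symmetric] by (auto split: if_splits)
  show "split_sign (tree_section (gen_c0 \<circ> g) [False]) \<longleftrightarrow> level_sign 0 g = split_sign (tree_section g [False])"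
    using c[OF level_one_elements(4)] v unfolding gen_c_wreath[symmetric] by (auto split: if_splits)
  show "split_sign (tree_section (gen_c1 \<circ> g) [False]) \<longleftrightarrow> split_sign (tree_section g [False])"
    using c[OF level_one_elements(5)] v unfolding gen_c_wreath[symmetric] by (auto split: if_splits)
  show "split_sign (tree_section (gen_c2 \<circ> g) [False]) \<longleftrightarrow> split_sign (tree_section g [False])"
    using c[OF level_one_elements(6)] v unfolding gen_c_wreath[symmetric] by (auto split: if_splits)
  show "split_sign (tree_section (gen_c3 \<circ> g) [False]) \<longleftrightarrow> split_sign (tree_section g [False])"
    using c[OF level_one_elements(3)] v unfolding gen_c_wreath[symmetric] by (auto split: if_splits)
qed

lemma level_sign_stabilizer:
  "g \<in> level_stabilizer second_basilica m \<Longrightarrow> n < m \<Longrightarrow> \<not> level_sign n g"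
proof (induction n arbitrary: g m)
  case 0
  then obtain k where k: "m = Suc k" by (cases m) auto
  obtain x y where g: "g = wreath x y id" "x \<in> level_stabilizer second_basilica k"
    using level_stabilizer_Suc[OF 0(1)[unfolded k]] by metis
  then have "x [] = []" by (simp add: level_stabilizer_def Basilica_Nil)
  then show ?case unfolding g(1) by simp
next
  case (Suc n)
  then obtain k where k: "m = Suc k" "n < k" by (cases m) auto
  obtain x y where g: "g = wreath x y id" "x \<in> level_stabilizer second_basilica k" "y \<in> level_stabilizer second_basilica k"
    using level_stabilizer_Suc[OF Suc(2)[unfolded k(1)]] by metis
  show ?case unfolding g(1) level_sign_Suc_wreath using Suc.IH[OF g(2) k(2)] Suc.IH[OF g(3) k(2)] by blast
qed

section \<open>Normal forms\<close>

definition power_bit :: "('a, 'b) monoid_scheme \<Rightarrow> 'a \<Rightarrow> bool \<Rightarrow> 'a" where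
  "power_bit G x e = (if e then x else \<one>\<^bsub>G\<^esub>)"

context group
begin

lemma power_bit_closed [simp]: "x \<in> carrier G \<Longrightarrow> power_bit G x e \<in> carrier G"
  by (simp add: power_bit_def)

lemma mult_power_bit:
  assumes "x \<in> carrier G" "x \<otimes> x = \<one>" "z \<in> carrier G"
  shows "x \<otimes> (power_bit G x e \<otimes> z) = power_bit G x (\<not> e) \<otimes> z"
  using assms by (simp add: power_bit_def flip: m_assoc)

lemma mult_power_bit_exchange:
  assumes "x \<in> carrier G" "y \<in> carrier G" "y' \<in> carrier G" "z \<in> carrier G" "x \<otimes> y = y' \<otimes> x"
  shows "x \<otimes> (power_bit G y e \<otimes> z) = power_bit G y' e \<otimes> (x \<otimes> z)"
  using assms by (simp add: power_bit_def flip: m_assoc)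

lemma power_bit_commute:
  assumes "x \<in> carrier G" "y \<in> carrier G" "z \<in> carrier G" "x \<otimes> y = y \<otimes> x"
  shows "power_bit G x e \<otimes> (power_bit G y f \<otimes> z) = power_bit G y f \<otimes> (power_bit G x e \<otimes> z)"
  using assms by (simp add: power_bit_def flip: m_assoc)

end

text \<open>
  The trailing factor \<open>\<one>\<close> lets every power stand in front of another factor, so that one set of exchange
  rules moves a letter through the whole product.
\<close>

definition normal_form ::
  "('a, 'b) monoid_scheme \<Rightarrow> 'a \<Rightarrow> 'a \<Rightarrow> 'a \<Rightarrow> 'a \<Rightarrow> 'a \<Rightarrow> 'a \<Rightarrow> bool \<Rightarrow> bool \<Rightarrow> bool \<Rightarrow> bool \<Rightarrow> bool \<Rightarrow> bool \<Rightarrow> bool \<Rightarrow> 'a"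
where
  "normal_form G a al c0 c1 c2 c3 e1 e2 e3 f0 f1 f2 f3 =
     power_bit G a e1 \<otimes>\<^bsub>G\<^esub> (power_bit G (al \<otimes>\<^bsub>G\<^esub> a \<otimes>\<^bsub>G\<^esub> al) e2 \<otimes>\<^bsub>G\<^esub> (power_bit G al e3 \<otimes>\<^bsub>G\<^esub>
     (power_bit G c0 f0 \<otimes>\<^bsub>G\<^esub> (power_bit G c1 f1 \<otimes>\<^bsub>G\<^esub> (power_bit G c2 f2 \<otimes>\<^bsub>G\<^esub> (power_bit G c3 f3 \<otimes>\<^bsub>G\<^esub> \<one>\<^bsub>G\<^esub>))))))"

text \<open>
  With \<open>b = al a al\<close>, both \<open>al\<close> and \<open>c0\<close> exchange \<open>a\<close> and \<open>b\<close> by conjugation; for \<open>c0\<close> this is the relation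
  that \<open>al c0\<close> commutes with \<open>a\<close>. Hence \<open>c0\<close> centralizes \<open>a b = [a, al]\<close>, and the last hypothesis yields
  that \<open>al\<close> and \<open>c0\<close> commute. A letter multiplied from the left can then be moved to its own place, at
  the price of exchanging the exponents of \<open>a\<close> and \<open>b\<close> when the letter is \<open>al\<close> or \<open>c0\<close>.
\<close>

lemma (in group) normal_form_mult:
  assumes car: "a \<in> carrier G" "al \<in> carrier G" "c0 \<in> carrier G" "c1 \<in> carrier G" "c2 \<in> carrier G" "c3 \<in> carrier G"
    and sq: "a \<otimes> a = \<one>" "al \<otimes> al = \<one>" "c0 \<otimes> c0 = \<one>" "c1 \<otimes> c1 = \<one>" "c2 \<otimes> c2 = \<one>" "c3 \<otimes> c3 = \<one>"
    and cc: "\<And>x y. x \<in> {c0, c1, c2, c3} \<Longrightarrow> y \<in> {c0, c1, c2, c3} \<Longrightarrow> x \<otimes> y = y \<otimes> x"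
    and ac: "\<And>c. c \<in> {c1, c2, c3} \<Longrightarrow> a \<otimes> c = c \<otimes> a"
    and alc: "\<And>c. c \<in> {c1, c2, c3} \<Longrightarrow> al \<otimes> c = c \<otimes> al"
    and b: "a \<otimes> (al \<otimes> a \<otimes> al) = (al \<otimes> a \<otimes> al) \<otimes> a"
    and alc0a: "(al \<otimes> c0) \<otimes> a = a \<otimes> (al \<otimes> c0)"
    and brc: "commutator G (commutator G a al) c0 = commutator G al c0"
  shows "a \<otimes> normal_form G a al c0 c1 c2 c3 e1 e2 e3 f0 f1 f2 f3 = normal_form G a al c0 c1 c2 c3 (\<not> e1) e2 e3 f0 f1 f2 f3"
    "al \<otimes> normal_form G a al c0 c1 c2 c3 e1 e2 e3 f0 f1 f2 f3 = normal_form G a al c0 c1 c2 c3 e2 e1 (\<not> e3) f0 f1 f2 f3"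
    "c0 \<otimes> normal_form G a al c0 c1 c2 c3 e1 e2 e3 f0 f1 f2 f3 = normal_form G a al c0 c1 c2 c3 e2 e1 e3 (\<not> f0) f1 f2 f3"
    "c1 \<otimes> normal_form G a al c0 c1 c2 c3 e1 e2 e3 f0 f1 f2 f3 = normal_form G a al c0 c1 c2 c3 e1 e2 e3 f0 (\<not> f1) f2 f3"
    "c2 \<otimes> normal_form G a al c0 c1 c2 c3 e1 e2 e3 f0 f1 f2 f3 = normal_form G a al c0 c1 c2 c3 e1 e2 e3 f0 f1 (\<not> f2) f3"
    "c3 \<otimes> normal_form G a al c0 c1 c2 c3 e1 e2 e3 f0 f1 f2 f3 = normal_form G a al c0 c1 c2 c3 e1 e2 e3 f0 f1 f2 (\<not> f3)"
proof -
  define b where "b = al \<otimes> a \<otimes> al"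
  have bc: "b \<in> carrier G" using car by (simp add: b_def)
  have cancel: "x \<otimes> (x \<otimes> z) = z" if "x \<otimes> x = \<one>" "x \<in> carrier G" "z \<in> carrier G" for x z
    using that by (simp flip: m_assoc)
  have ab: "a \<otimes> b = b \<otimes> a" using b by (simp add: b_def)
  have ala: "al \<otimes> a = b \<otimes> al" using car sq by (simp add: b_def m_assoc)
  have alb: "al \<otimes> b = a \<otimes> al" using car sq by (simp add: b_def m_assoc cancel)
  have bb: "b \<otimes> b = \<one>" using car sq by (simp add: b_def m_assoc cancel)
  have "c0 \<otimes> a = al \<otimes> ((al \<otimes> c0) \<otimes> a)" using car sq by (simp add: m_assoc cancel)
  also have "\<dots> = b \<otimes> c0" unfolding alc0a using car by (simp add: b_def m_assoc)
  finally have c0a: "c0 \<otimes> a = b \<otimes> c0" .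
  have "c0 \<otimes> b = c0 \<otimes> (b \<otimes> c0) \<otimes> c0" using car bc sq by (simp add: m_assoc)
  also have "\<dots> = a \<otimes> c0" unfolding c0a[symmetric] using car sq by (simp add: cancel)
  finally have c0b: "c0 \<otimes> b = a \<otimes> c0" .
  have inv: "inv a = a" "inv al = al" "inv c0 = c0" "inv b = b"
    using car sq bc bb by (auto intro: inv_equality)
  have "commutator G a al = a \<otimes> b" using car inv by (simp add: commutator_def b_def m_assoc)
  moreover have "c0 \<otimes> (a \<otimes> b) = (a \<otimes> b) \<otimes> c0"
    using car bc by (metis c0a c0b ab m_assoc)
  then have "commutator G (a \<otimes> b) c0 = \<one>"
    using car bc by (metis commutator_def m_assoc r_inv m_closed inv_closed r_one)
  ultimately have "commutator G al c0 = \<one>" using brc by simp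
  then have "al \<otimes> c0 \<otimes> inv (c0 \<otimes> al) = \<one>"
    using car by (simp add: commutator_def inv_mult_group m_assoc)
  then have alc0: "al \<otimes> c0 = c0 \<otimes> al"
    using car by (metis inv_equality inv_inv inv_closed m_closed)
  have lcomm: "x \<otimes> (y \<otimes> z) = y \<otimes> (x \<otimes> z)"
    if "y \<otimes> x = x \<otimes> y" "x \<in> carrier G" "y \<in> carrier G" "z \<in> carrier G" for x y z
    using that by (simp flip: m_assoc)
  have bc': "c \<otimes> b = b \<otimes> c" if "c \<in> {c1, c2, c3}" for c
  proof -
    have cG: "c \<in> carrier G" using that car by blast
    show ?thesis
      unfolding b_def using car cG ac[OF that] alc[OF that]
      by (simp add: m_assoc lcomm[OF alc[OF that]] lcomm[OF ac[OF that]])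
  qed
  note ex = mult_power_bit_exchange[OF _ _ _ _ ab] mult_power_bit_exchange[OF _ _ _ _ ala]
    mult_power_bit_exchange[OF _ _ _ _ alb] mult_power_bit_exchange[OF _ _ _ _ c0a] mult_power_bit_exchange[OF _ _ _ _ c0b]
    mult_power_bit_exchange[OF _ _ _ _ alc0[symmetric]]
    mult_power_bit_exchange[OF _ _ _ _ bc'[of c1]] mult_power_bit_exchange[OF _ _ _ _ bc'[of c2]] mult_power_bit_exchange[OF _ _ _ _ bc'[of c3]]
    mult_power_bit_exchange[OF _ _ _ _ ac[of c1, symmetric]] mult_power_bit_exchange[OF _ _ _ _ ac[of c2, symmetric]] mult_power_bit_exchange[OF _ _ _ _ ac[of c3, symmetric]]
    mult_power_bit_exchange[OF _ _ _ _ alc[of c1, symmetric]] mult_power_bit_exchange[OF _ _ _ _ alc[of c2, symmetric]] mult_power_bit_exchange[OF _ _ _ _ alc[of c3, symmetric]]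
    mult_power_bit_exchange[OF _ _ _ _ cc[of c1 c0]] mult_power_bit_exchange[OF _ _ _ _ cc[of c2 c0]] mult_power_bit_exchange[OF _ _ _ _ cc[of c3 c0]]
    mult_power_bit_exchange[OF _ _ _ _ cc[of c2 c1]] mult_power_bit_exchange[OF _ _ _ _ cc[of c3 c1]] mult_power_bit_exchange[OF _ _ _ _ cc[of c3 c2]]
  note nf = normal_form_def[where G = G and al = al and a = a, folded b_def]
  note swap = power_bit_commute[OF bc car(1) _ ab[symmetric]]
  show "a \<otimes> normal_form G a al c0 c1 c2 c3 e1 e2 e3 f0 f1 f2 f3 = normal_form G a al c0 c1 c2 c3 (\<not> e1) e2 e3 f0 f1 f2 f3"
    unfolding nf using car bc sq by (simp add: mult_power_bit)
  show "al \<otimes> normal_form G a al c0 c1 c2 c3 e1 e2 e3 f0 f1 f2 f3 = normal_form G a al c0 c1 c2 c3 e2 e1 (\<not> e3) f0 f1 f2 f3"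
    unfolding nf using car bc sq by (simp add: ex mult_power_bit swap)
  show "c0 \<otimes> normal_form G a al c0 c1 c2 c3 e1 e2 e3 f0 f1 f2 f3 = normal_form G a al c0 c1 c2 c3 e2 e1 e3 (\<not> f0) f1 f2 f3"
    unfolding nf using car bc sq by (simp add: ex mult_power_bit swap)
  show "c1 \<otimes> normal_form G a al c0 c1 c2 c3 e1 e2 e3 f0 f1 f2 f3 = normal_form G a al c0 c1 c2 c3 e1 e2 e3 f0 (\<not> f1) f2 f3"
    unfolding nf using car bc sq by (simp add: ex mult_power_bit)
  show "c2 \<otimes> normal_form G a al c0 c1 c2 c3 e1 e2 e3 f0 f1 f2 f3 = normal_form G a al c0 c1 c2 c3 e1 e2 e3 f0 f1 (\<not> f2) f3"
    unfolding nf using car bc sq by (simp add: ex mult_power_bit)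
  have last: "c3 \<otimes> power_bit G c3 f3 = power_bit G c3 (\<not> f3)"
    using mult_power_bit[OF car(6) sq(6) one_closed] car by simp
  show "c3 \<otimes> normal_form G a al c0 c1 c2 c3 e1 e2 e3 f0 f1 f2 f3 = normal_form G a al c0 c1 c2 c3 e1 e2 e3 f0 f1 f2 (\<not> f3)"
    unfolding nf using car bc sq by (simp add: ex last)
qed

text \<open>
  The exponents of \<open>\<alpha>, c\<^sub>0, c\<^sub>1, c\<^sub>2, c\<^sub>3\<close> are the parities of the levels 1, 5, 4, 3, 2. The exponents \<open>e1\<close> and
  \<open>e2\<close> of \<open>a\<close> and \<open>\<alpha> a \<alpha>\<close> add up to the parity of level 0. To separate them, note that
  \<open>\<alpha> a \<alpha> = a (a, a)\<close> has odd split sign at 0 and \<open>a\<close> has even one, while \<open>\<alpha> = (a, 1)\<close> and \<open>c\<^sub>0 = (c\<^sub>1, 1)\<close>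
  contribute 1 each; so \<open>e2\<close> is the split sign of the section at 0 corrected by the exponents of \<open>\<alpha>\<close> and \<open>c\<^sub>0\<close>.
  The proof checks that multiplication by a generator has the same effect on both sides.
\<close>

lemma coset_normal_form:
  assumes N: "N \<lhd> Basilica"
    and rel_a: "\<And>c. c \<in> {gen_c1, gen_c2, gen_c3} \<Longrightarrow> commutator Basilica gen_a c \<in> N"
    and rel_alpha: "\<And>c. c \<in> {gen_c1, gen_c2, gen_c3} \<Longrightarrow> commutator Basilica gen_alpha c \<in> N"
    and rel_c0: "commutator Basilica (gen_alpha \<circ> gen_c0) gen_a \<in> N"
    and g: "g \<in> second_basilica"
  defines "p \<equiv> \<lambda>x. N #>\<^bsub>Basilica\<^esub> x"
    and "e2 \<equiv> \<lambda>g. split_sign (tree_section g [False]) \<noteq> (level_sign 1 g \<noteq> level_sign 5 g)"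
  defines "e1 \<equiv> \<lambda>g. level_sign 0 g \<noteq> e2 g"
  shows "p g = normal_form (Basilica Mod N) (p gen_a) (p gen_alpha) (p gen_c0) (p gen_c1) (p gen_c2) (p gen_c3)
    (e1 g) (e2 g) (level_sign 1 g) (level_sign 5 g) (level_sign 4 g) (level_sign 3 g) (level_sign 2 g)"
    (is "p g = ?nf _ _ _ _ _ _ _")
proof -
  note B = generators_in_Basilica
  let ?Q = "Basilica Mod N"
  have Q: "group ?Q" by (rule normal.factorgroup_is_group[OF N])
  have p_mult: "p (x \<circ> y) = p x \<otimes>\<^bsub>?Q\<^esub> p y" if "x \<in> second_basilica" "y \<in> second_basilica" for x y
    using normal.rcos_sum[OF N] that by (simp add: p_def)
  have p_car: "p x \<in> carrier ?Q" if "x \<in> second_basilica" for x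
    using that by (simp add: p_def carrier_FactGroup)
  have p_one: "p id = \<one>\<^bsub>?Q\<^esub>"
    using Basilica.coset_mult_one[OF normal_subset[OF N]] by (simp add: p_def)
  have hom: "p \<in> hom Basilica ?Q"
    using p_mult p_car by (simp add: hom_def Pi_def del: mult_FactGroup)
  interpret hom: group_hom Basilica ?Q p
    by (rule group_hom.intro[OF group_Basilica Q]) (simp add: group_hom_axioms_def hom)
  have p_comm: "commutator ?Q (p x) (p y) = p (commutator Basilica x y)"
    if "x \<in> second_basilica" "y \<in> second_basilica" for x y
    using that by (simp add: commutator_def hom.hom_inv p_mult del: mult_FactGroup)
  have commute: "p x \<otimes>\<^bsub>?Q\<^esub> p y = p y \<otimes>\<^bsub>?Q\<^esub> p x"
    if "commutator Basilica x y \<in> N" "x \<in> second_basilica" "y \<in> second_basilica" for x y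
    using Basilica.commutator_mem_iff[OF N that(2,3)] that(1)
    unfolding p_mult[OF that(2,3), symmetric] p_mult[OF that(3,2), symmetric]
    unfolding p_def by blast
  have sq: "p x \<otimes>\<^bsub>?Q\<^esub> p x = \<one>\<^bsub>?Q\<^esub>" if "x \<in> second_basilica" "x \<circ> x = id" for x
    unfolding p_mult[OF that(1,1), symmetric] that(2) by (rule p_one)
  have dihedral: "gen_a \<circ> (gen_alpha \<circ> gen_a \<circ> gen_alpha) = (gen_alpha \<circ> gen_a \<circ> gen_alpha) \<circ> gen_a"
    by (simp only: gen_a_def gen_alpha_def wreath_comp Not_comp_Not comp_id id_comp)
  have aca: "p x \<otimes>\<^bsub>?Q\<^esub> p y = p y \<otimes>\<^bsub>?Q\<^esub> p x"
    if "x \<in> second_basilica" "y \<in> second_basilica" "x \<circ> y = y \<circ> x" for x y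
    unfolding p_mult[OF that(1,2), symmetric] p_mult[OF that(2,1), symmetric] that(3) ..
  note nf_mult = group.normal_form_mult[OF Q, of "p gen_a" "p gen_alpha" "p gen_c0" "p gen_c1" "p gen_c2" "p gen_c3"]
  have C: "p x \<otimes>\<^bsub>?Q\<^esub> p y = p y \<otimes>\<^bsub>?Q\<^esub> p x"
    if "x \<in> {gen_c0, gen_c1, gen_c2, gen_c3}" "y \<in> {gen_c0, gen_c1, gen_c2, gen_c3}" for x y
    using that B by (intro aca generators_c_commute) blast+
  have CC: "x \<otimes>\<^bsub>?Q\<^esub> y = y \<otimes>\<^bsub>?Q\<^esub> x"
    if xy: "x \<in> {p gen_c0, p gen_c1, p gen_c2, p gen_c3}" "y \<in> {p gen_c0, p gen_c1, p gen_c2, p gen_c3}" for x y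
  proof -
    obtain x' y' where "x = p x'" "y = p y'" "x' \<in> {gen_c0, gen_c1, gen_c2, gen_c3}" "y' \<in> {gen_c0, gen_c1, gen_c2, gen_c3}"
      using xy by blast
    with C show ?thesis by blast
  qed
  have A: "p gen_a \<otimes>\<^bsub>?Q\<^esub> c = c \<otimes>\<^bsub>?Q\<^esub> p gen_a" "p gen_alpha \<otimes>\<^bsub>?Q\<^esub> c = c \<otimes>\<^bsub>?Q\<^esub> p gen_alpha"
    if "c \<in> {p gen_c1, p gen_c2, p gen_c3}" for c
    using that commute[OF rel_a B(1)] commute[OF rel_alpha B(2)] B(4-6) by blast+
  have bb: "p gen_a \<otimes>\<^bsub>?Q\<^esub> (p gen_alpha \<otimes>\<^bsub>?Q\<^esub> p gen_a \<otimes>\<^bsub>?Q\<^esub> p gen_alpha) =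
      (p gen_alpha \<otimes>\<^bsub>?Q\<^esub> p gen_a \<otimes>\<^bsub>?Q\<^esub> p gen_alpha) \<otimes>\<^bsub>?Q\<^esub> p gen_a"
    using aca[OF B(1) _ dihedral] B
    by (simp only: p_mult[OF B(2) B(1)] p_mult[OF Basilica.m_closed[OF B(2,1)] B(2)] Basilica.m_closed)
  have rc: "(p gen_alpha \<otimes>\<^bsub>?Q\<^esub> p gen_c0) \<otimes>\<^bsub>?Q\<^esub> p gen_a = p gen_a \<otimes>\<^bsub>?Q\<^esub> (p gen_alpha \<otimes>\<^bsub>?Q\<^esub> p gen_c0)"
    using commute[OF rel_c0 Basilica.m_closed[OF B(2,3)] B(1)] by (simp only: p_mult[OF B(2,3)])
  have brc: "commutator ?Q (commutator ?Q (p gen_a) (p gen_alpha)) (p gen_c0) = commutator ?Q (p gen_alpha) (p gen_c0)"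
    by (simp only: p_comm[OF B(1,2)] p_comm[OF B(2,3)] p_comm[OF Basilica.commutator_closed[OF B(1,2)] B(3)] commutator_a_alpha_c0)
  note nf_mult = nf_mult[OF B[THEN p_car] sq[OF B(1) generators_involutive(1)] sq[OF B(2) generators_involutive(2)]
      sq[OF B(3) generators_involutive(3)] sq[OF B(4) generators_involutive(4)]
      sq[OF B(5) generators_involutive(5)] sq[OF B(6) generators_involutive(6)] CC A bb rc brc]
  from g show ?thesis
  proof (induction rule: Basilica_induct)
    case id
    have "tree_section id [False] = id" by (auto simp: tree_section_def)
    then have "\<not> split_sign (tree_section id [False])"
      by (simp add: split_sign_def level_sign_generators(1))
    then have "\<not> e2 id" unfolding e2_def using level_sign_generators(1) by blast
    then have "\<not> e1 id" unfolding e1_def using level_sign_generators(1) by blast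
    with \<open>\<not> e2 id\<close> show ?case
      by (simp only: p_one normal_form_def power_bit_def level_sign_generators)
        (simp only: if_False simp_thms group.is_monoid[OF Q, THEN monoid.l_one] group.is_monoid[OF Q, THEN monoid.one_closed])
  next
    case (mult x g)
    have xB: "x \<in> second_basilica" using mult(1) generators_subset by blast
    note [simp del] = level_sign.simps mult_FactGroup one_FactGroup
    note px = p_mult[OF xB mult(2), unfolded mult(3)]
    have signs: "level_sign n (x \<circ> g) \<longleftrightarrow> level_sign n x \<noteq> level_sign n g" for n
      by (rule level_sign_comp[OF xB mult(2)])
    note split = split_sign_generators_comp[OF mult(2)]
    from mult(1) show ?case
    proof (elim insertE emptyE)
      assume x: "x = gen_a"
      have signs:
        "level_sign 1 (x \<circ> g) = level_sign 1 g" "level_sign 5 (x \<circ> g) = level_sign 5 g" "level_sign 4 (x \<circ> g) = level_sign 4 g"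
        "level_sign 3 (x \<circ> g) = level_sign 3 g" "level_sign 2 (x \<circ> g) = level_sign 2 g"
        unfolding signs unfolding x by (simp_all add: level_sign_generators)
      have sign0: "level_sign 0 (x \<circ> g) = (\<not> level_sign 0 g)"
        unfolding level_sign_comp[OF xB mult(2)] unfolding x by (simp add: level_sign_generators)
      have e2: "e2 (x \<circ> g) = e2 g"
        unfolding e1_def e2_def signs unfolding x split by blast
      have e1: "e1 (x \<circ> g) = (\<not> e1 g)"
        unfolding e1_def e2 sign0 by (auto simp: e1_def)
      show ?thesis unfolding px e1 e2 signs unfolding x by (rule nf_mult)
    next
      assume x: "x = gen_alpha"
      have signs:
        "level_sign 1 (x \<circ> g) = (\<not> level_sign 1 g)" "level_sign 5 (x \<circ> g) = level_sign 5 g" "level_sign 4 (x \<circ> g) = level_sign 4 g"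
        "level_sign 3 (x \<circ> g) = level_sign 3 g" "level_sign 2 (x \<circ> g) = level_sign 2 g"
        unfolding signs unfolding x by (simp_all add: level_sign_generators)
      have sign0: "level_sign 0 (x \<circ> g) = level_sign 0 g"
        unfolding level_sign_comp[OF xB mult(2)] unfolding x by (simp add: level_sign_generators)
      have e2: "e2 (x \<circ> g) = e1 g"
        unfolding e1_def e2_def signs unfolding x split by blast
      have e1: "e1 (x \<circ> g) = e2 g"
        unfolding e1_def e2 sign0 by (auto simp: e1_def)
      show ?thesis unfolding px e1 e2 signs unfolding x by (rule nf_mult)
    next
      assume x: "x = gen_c0"
      have signs:
        "level_sign 1 (x \<circ> g) = level_sign 1 g" "level_sign 5 (x \<circ> g) = (\<not> level_sign 5 g)" "level_sign 4 (x \<circ> g) = level_sign 4 g"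
        "level_sign 3 (x \<circ> g) = level_sign 3 g" "level_sign 2 (x \<circ> g) = level_sign 2 g"
        unfolding signs unfolding x by (simp_all add: level_sign_generators)
      have sign0: "level_sign 0 (x \<circ> g) = level_sign 0 g"
        unfolding level_sign_comp[OF xB mult(2)] unfolding x by (simp add: level_sign_generators)
      have e2: "e2 (x \<circ> g) = e1 g"
        unfolding e1_def e2_def signs unfolding x split by blast
      have e1: "e1 (x \<circ> g) = e2 g"
        unfolding e1_def e2 sign0 by (auto simp: e1_def)
      show ?thesis unfolding px e1 e2 signs unfolding x by (rule nf_mult)
    next
      assume x: "x = gen_c1"
      have signs:
        "level_sign 1 (x \<circ> g) = level_sign 1 g" "level_sign 5 (x \<circ> g) = level_sign 5 g" "level_sign 4 (x \<circ> g) = (\<not> level_sign 4 g)"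
        "level_sign 3 (x \<circ> g) = level_sign 3 g" "level_sign 2 (x \<circ> g) = level_sign 2 g"
        unfolding signs unfolding x by (simp_all add: level_sign_generators)
      have sign0: "level_sign 0 (x \<circ> g) = level_sign 0 g"
        unfolding level_sign_comp[OF xB mult(2)] unfolding x by (simp add: level_sign_generators)
      have e2: "e2 (x \<circ> g) = e2 g"
        unfolding e1_def e2_def signs unfolding x split by blast
      have e1: "e1 (x \<circ> g) = e1 g"
        unfolding e1_def e2 sign0 by (auto simp: e1_def)
      show ?thesis unfolding px e1 e2 signs unfolding x by (rule nf_mult)
    next
      assume x: "x = gen_c2"
      have signs:
        "level_sign 1 (x \<circ> g) = level_sign 1 g" "level_sign 5 (x \<circ> g) = level_sign 5 g" "level_sign 4 (x \<circ> g) = level_sign 4 g"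
        "level_sign 3 (x \<circ> g) = (\<not> level_sign 3 g)" "level_sign 2 (x \<circ> g) = level_sign 2 g"
        unfolding signs unfolding x by (simp_all add: level_sign_generators)
      have sign0: "level_sign 0 (x \<circ> g) = level_sign 0 g"
        unfolding level_sign_comp[OF xB mult(2)] unfolding x by (simp add: level_sign_generators)
      have e2: "e2 (x \<circ> g) = e2 g"
        unfolding e1_def e2_def signs unfolding x split by blast
      have e1: "e1 (x \<circ> g) = e1 g"
        unfolding e1_def e2 sign0 by (auto simp: e1_def)
      show ?thesis unfolding px e1 e2 signs unfolding x by (rule nf_mult)
    next
      assume x: "x = gen_c3"
      have signs:
        "level_sign 1 (x \<circ> g) = level_sign 1 g" "level_sign 5 (x \<circ> g) = level_sign 5 g" "level_sign 4 (x \<circ> g) = level_sign 4 g"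
        "level_sign 3 (x \<circ> g) = level_sign 3 g" "level_sign 2 (x \<circ> g) = (\<not> level_sign 2 g)"
        unfolding signs unfolding x by (simp_all add: level_sign_generators)
      have sign0: "level_sign 0 (x \<circ> g) = level_sign 0 g"
        unfolding level_sign_comp[OF xB mult(2)] unfolding x by (simp add: level_sign_generators)
      have e2: "e2 (x \<circ> g) = e2 g"
        unfolding e1_def e2_def signs unfolding x split by blast
      have e1: "e1 (x \<circ> g) = e1 g"
        unfolding e1_def e2 sign0 by (auto simp: e1_def)
      show ?thesis unfolding px e1 e2 signs unfolding x by (rule nf_mult)
    qed
  qed
qed

lemma level_stabilizer_subset_of_relations:
  assumes N: "N \<lhd> Basilica"
    and rel_a: "\<And>c. c \<in> {gen_c1, gen_c2, gen_c3} \<Longrightarrow> commutator Basilica gen_a c \<in> N"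
    and rel_alpha: "\<And>c. c \<in> {gen_c1, gen_c2, gen_c3} \<Longrightarrow> commutator Basilica gen_alpha c \<in> N"
    and rel_c0: "commutator Basilica (gen_alpha \<circ> gen_c0) gen_a \<in> N"
  shows "level_stabilizer second_basilica 6 \<subseteq> N"
proof
  fix g assume g: "g \<in> level_stabilizer second_basilica 6"
  then have gB: "g \<in> second_basilica" by (simp add: level_stabilizer_def)
  have signs: "\<not> level_sign n g" if "n < 6" for n using level_sign_stabilizer[OF g that] .
  have "g \<in> level_stabilizer second_basilica (Suc 5)" using g by simp
  from level_stabilizer_Suc[OF this]
  obtain x y where xy: "g = wreath x y id" "x \<in> level_stabilizer second_basilica 5" .
  have "\<not> split_sign x"
    unfolding split_sign_def using level_sign_stabilizer[OF xy(2), of 0] level_sign_stabilizer[OF xy(2), of 4] by auto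
  then have split: "split_sign (tree_section g [False]) = False"
    unfolding xy(1) tree_section_wreath by blast
  have s: "level_sign 0 g = False" "level_sign 1 g = False" "level_sign 2 g = False"
    "level_sign 3 g = False" "level_sign 4 g = False" "level_sign 5 g = False"
    using signs[of 0] signs[of 1] signs[of 2] signs[of 3] signs[of 4] signs[of 5] by (auto simp del: level_sign.simps)
  have Q: "monoid (Basilica Mod N)"
    by (rule group.is_monoid[OF normal.factorgroup_is_group[OF N]])
  have "N #>\<^bsub>Basilica\<^esub> g = \<one>\<^bsub>Basilica Mod N\<^esub>"
    using coset_normal_form[OF N rel_a rel_alpha rel_c0 gB]
    by (simp only: s split normal_form_def power_bit_def simp_thms if_False monoid.l_one[OF Q] monoid.one_closed[OF Q])
  then have "N #>\<^bsub>Basilica\<^esub> g = N" by simp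
  then show "g \<in> N"
    using Basilica.rcos_self[OF gB normal_imp_subgroup[OF N]] by simp
qed

section \<open>Normal subgroups and displaced vertices\<close>

primrec graft :: "word \<Rightarrow> (word \<Rightarrow> word) \<Rightarrow> word \<Rightarrow> word" where
  "graft [] k = k"
| "graft (i # v) k = (if i then wreath id (graft v k) id else wreath (graft v k) id id)"

text \<open>
  Since the two coordinate subgroups of a normal subgroup coincide, only the length of \<open>v\<close> matters.
\<close>

lemma graft_mem_iff:
  "N \<lhd> Basilica \<Longrightarrow> graft v k \<in> N \<longleftrightarrow> k \<in> (coordinate_subgroup ^^ length v) N"
proof (induction v arbitrary: N)
  case (Cons i v)
  have "graft (i # v) k \<in> N \<longleftrightarrow> graft v k \<in> coordinate_subgroup N"
    using second_coordinate_mem_iff[OF Cons.prems, of "graft v k"] by (simp add: coordinate_subgroup_def)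
  also have "\<dots> \<longleftrightarrow> k \<in> (coordinate_subgroup ^^ length (i # v)) N"
    using Cons.IH[OF coordinate_subgroup_normal[OF Cons.prems]]
    by (simp only: list.size add_Suc_right add_0_right funpow_Suc_right o_apply)
  finally show ?case .
qed simp

lemma graft_section:
  "graft (i # v) k \<in> second_basilica \<Longrightarrow> graft v k \<in> second_basilica"
  using Basilica_sections[of "graft v k" id id] Basilica_sections[of id "graft v k" id]
  by (simp split: if_splits)

lemma commutator_id: "x \<in> second_basilica \<Longrightarrow> commutator Basilica x id = id"
  by (intro commutator_eq_id Basilica.one_closed) auto

lemma commutator_graft:
  "graft v k \<in> second_basilica \<Longrightarrow> graft v l \<in> second_basilica \<Longrightarrow>
    commutator Basilica (graft v k) (graft v l) = graft v (commutator Basilica k l)"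
proof (induction v)
  case (Cons i v)
  note IH = Cons.IH[OF graft_section[OF Cons.prems(1)] graft_section[OF Cons.prems(2)]]
  have id: "commutator Basilica id id = id" by (rule commutator_id[OF Basilica.one_closed])
  show ?case
  proof (cases i)
    case True
    then have "wreath id (graft v k) id \<in> second_basilica" "wreath id (graft v l) id \<in> second_basilica"
      using Cons.prems by simp_all
    from commutator_wreath[OF this] show ?thesis
      unfolding IH id using True by simp
  next
    case False
    then have "wreath (graft v k) id id \<in> second_basilica" "wreath (graft v l) id id \<in> second_basilica"
      using Cons.prems by simp_all
    from commutator_wreath[OF this] show ?thesis
      unfolding IH id using False by simp
  qed
qed simp

lemma inv_wreath_Basilica:
  assumes "wreath x y id \<in> second_basilica"
  shows "inv\<^bsub>Basilica\<^esub> (wreath x y id) = wreath (inv\<^bsub>Basilica\<^esub> x) (inv\<^bsub>Basilica\<^esub> y) id"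
  using Basilica_sections[OF assms]
  by (simp only: inv_Basilica[OF assms] inv_Basilica inv_wreath[OF bij_Basilica bij_Basilica])

text \<open>
  The conjugate of \<open>(x, y)\<close> by \<open>(p, q) \<tau>\<close> is \<open>(q y q^-1, p x p^-1)\<close>.
\<close>

lemma commutator_swap:
  assumes g: "wreath p q Not \<in> second_basilica" and k: "wreath x y id \<in> second_basilica"
  shows "commutator Basilica (wreath p q Not) (wreath x y id) =
    wreath (q \<circ> y \<circ> inv\<^bsub>Basilica\<^esub> q \<circ> inv\<^bsub>Basilica\<^esub> x) (p \<circ> x \<circ> inv\<^bsub>Basilica\<^esub> p \<circ> inv\<^bsub>Basilica\<^esub> y) id"
proof -
  note pq = Basilica_sections[OF g] and xy = Basilica_sections[OF k]
  have cancel: "z \<circ> inv\<^bsub>Basilica\<^esub> u \<circ> u = z" if "u \<in> second_basilica" for z u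
    using Basilica.l_inv[OF that] by (simp only: comp_assoc comp_id)
  let ?w = "wreath (q \<circ> y \<circ> inv\<^bsub>Basilica\<^esub> q) (p \<circ> x \<circ> inv\<^bsub>Basilica\<^esub> p) id"
  have "wreath p q Not \<circ> wreath x y id = ?w \<circ> wreath p q Not"
    unfolding wreath_comp cancel[OF pq(1)] cancel[OF pq(2)] by simp
  then have "commutator Basilica (wreath p q Not) (wreath x y id) =
    ?w \<circ> wreath p q Not \<circ> inv\<^bsub>Basilica\<^esub> (wreath p q Not) \<circ> inv\<^bsub>Basilica\<^esub> (wreath x y id)"
    by (simp only: commutator_def Basilica_mult)
  also have "\<dots> = ?w \<circ> inv\<^bsub>Basilica\<^esub> (wreath x y id)"
    using Basilica.r_inv[OF g] by (simp only: comp_assoc id_comp)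
  finally show ?thesis by (simp only: inv_wreath_Basilica[OF k] wreath_comp)
qed

text \<open>
  The recursion follows \<open>v\<close> as long as \<open>g\<close> fixes its letters. At the first letter that \<open>g\<close> moves, the conjugate of
  \<open>k\<^sub>v\<close> lives in the other coordinate than \<open>l\<^sub>v\<close>, so only \<open>k\<^sub>v^-1\<close> contributes to the outer commutator.
\<close>

lemma double_commutator_graft:
  assumes "g \<in> second_basilica" "g v \<noteq> v" "graft v k \<in> second_basilica" "graft v l \<in> second_basilica"
  shows "commutator Basilica (commutator Basilica g (graft v k)) (graft v l) =
    commutator Basilica (inv\<^bsub>Basilica\<^esub> (graft v k)) (graft v l)"
  using assms
proof (induction v arbitrary: g)
  case Nil
  then show ?case by (simp add: Basilica_Nil)
next
  case (Cons i v)
  obtain p q s where g: "g = wreath p q s" "p \<in> second_basilica" "q \<in> second_basilica" "s = id \<or> s = Not"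
    using Basilica_wreath[OF Cons.prems(1)] .
  define x y where "x = graft v k" and "y = graft v l"
  have xy: "x \<in> second_basilica" "y \<in> second_basilica"
    using Cons.prems graft_section unfolding x_def y_def by blast+
  have id1: "id \<in> second_basilica" by (rule Basilica.one_closed)
  have inv_id: "inv\<^bsub>Basilica\<^esub> id = id" by (rule Basilica.inv_one)
  have inv_closed: "inv\<^bsub>Basilica\<^esub> z \<in> second_basilica" if "z \<in> second_basilica" for z
    using that by (rule Basilica.inv_closed)
  have conj_id: "z \<circ> id \<circ> inv\<^bsub>Basilica\<^esub> z = id" if "z \<in> second_basilica" for z
    using Basilica.r_inv[OF that] by (simp only: comp_id)
  note KL = Cons.prems(3,4)
  have gK: "commutator Basilica g (graft (i # v) k) \<in> second_basilica"
    by (rule Basilica.commutator_closed[OF Cons.prems(1) KL(1)])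
  have iK: "inv\<^bsub>Basilica\<^esub> (graft (i # v) k) \<in> second_basilica" by (rule inv_closed[OF KL(1)])
  show ?case
  proof (cases i)
    case True
    have K: "graft (i # v) k = wreath id x id" "graft (i # v) l = wreath id y id"
      using True by (simp_all add: x_def y_def)
    note KL' = KL[unfolded K] and gK' = gK[unfolded g(1) K] and iK' = iK[unfolded K inv_wreath_Basilica[OF KL(1)[unfolded K]]]
    show ?thesis
    proof (cases "s = id")
      case s: True
      have "q v \<noteq> v" using Cons.prems(2) True g(1) s by auto
      note IH = Cons.IH[OF g(3) this xy[unfolded x_def y_def], folded x_def y_def]
      note gB = Cons.prems(1)[unfolded g(1) s]
      note c = commutator_wreath[OF gB KL'(1)]
      show ?thesis unfolding K g(1) s inv_wreath_Basilica[OF KL'(1)] c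
        unfolding commutator_wreath[OF gK'[unfolded s c] KL'(2)] commutator_wreath[OF iK' KL'(2)]
        unfolding IH commutator_id[OF g(2)] inv_id ..
    next
      case False
      then have s: "s = Not" using g(4) by blast
      note gB = Cons.prems(1)[unfolded g(1) s]
      note c = commutator_swap[OF gB KL'(1), unfolded conj_id[OF g(2)] id_comp]
      note gK'' = gK'[unfolded s c]
      show ?thesis unfolding K g(1) s inv_wreath_Basilica[OF KL'(1)] c
        unfolding commutator_wreath[OF gK'' KL'(2)] commutator_wreath[OF iK' KL'(2)]
        unfolding commutator_id[OF Basilica_sections(1)[OF gK'']]
        unfolding inv_id commutator_id[OF id1] ..
    qed
  next
    case False
    have K: "graft (i # v) k = wreath x id id" "graft (i # v) l = wreath y id id"
      using False by (simp_all add: x_def y_def)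
    note KL' = KL[unfolded K] and gK' = gK[unfolded g(1) K] and iK' = iK[unfolded K inv_wreath_Basilica[OF KL(1)[unfolded K]]]
    show ?thesis
    proof (cases "s = id")
      case s: True
      have "p v \<noteq> v" using Cons.prems(2) False g(1) s by auto
      note IH = Cons.IH[OF g(2) this xy[unfolded x_def y_def], folded x_def y_def]
      note gB = Cons.prems(1)[unfolded g(1) s]
      note c = commutator_wreath[OF gB KL'(1)]
      show ?thesis unfolding K g(1) s inv_wreath_Basilica[OF KL'(1)] c
        unfolding commutator_wreath[OF gK'[unfolded s c] KL'(2)] commutator_wreath[OF iK' KL'(2)]
        unfolding IH commutator_id[OF g(3)] inv_id ..
    next
      case notid: False
      then have s: "s = Not" using g(4) by blast
      note gB = Cons.prems(1)[unfolded g(1) s]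
      note c = commutator_swap[OF gB KL'(1), unfolded conj_id[OF g(3)] id_comp]
      note gK'' = gK'[unfolded s c]
      show ?thesis unfolding K g(1) s inv_wreath_Basilica[OF KL'(1)] c
        unfolding commutator_wreath[OF gK'' KL'(2)] commutator_wreath[OF iK' KL'(2)]
        unfolding commutator_id[OF Basilica_sections(2)[OF gK'']]
        unfolding inv_id commutator_id[OF id1] ..
    qed
  qed
qed

lemma derived_commutator_coordinate_power:
  assumes N: "N \<lhd> Basilica" and g: "g \<in> N" "g v \<noteq> v"
    and kl: "k \<in> basilica_derived" "l \<in> basilica_derived"
  shows "commutator Basilica k l \<in> (coordinate_subgroup ^^ length v) N"
proof -
  have gB: "g \<in> second_basilica" using g(1) normal_subset[OF N] by blast
  have branch: "basilica_derived \<subseteq> (coordinate_subgroup ^^ n) basilica_derived" for n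
  proof (induction n)
    case (Suc n)
    show ?case
      using derived_subset_coordinate_derived coordinate_subgroup_mono[OF Suc] by simp
  qed simp
  have graft: "graft v m \<in> second_basilica" if "m \<in> basilica_derived" for m
    using graft_mem_iff[OF derived_normal, of v m] subsetD[OF branch that] normal_subset[OF derived_normal] by blast
  let ?K = "graft v k" and ?L = "graft v l"
  have KL: "?K \<in> second_basilica" "?L \<in> second_basilica" using kl by (auto intro: graft)
  have "commutator Basilica (commutator Basilica g ?K) ?L \<in> N"
    by (intro Basilica.commutator_mem_normal(1) N g KL)
  \<comment> \<open>The double commutator puts \<open>k\<^sub>v^-1\<close>, hence \<open>k\<^sub>v\<close>, into the centralizer of \<open>l\<^sub>v\<close> modulo \<open>N\<close>.\<close>
  then have "inv\<^bsub>Basilica\<^esub> ?K \<in> centralizer_mod Basilica {?L} N"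
    unfolding double_commutator_graft[OF gB g(2) KL] using KL by (simp add: centralizer_mod_def)
  moreover have "subgroup (centralizer_mod Basilica {?L} N) Basilica"
    using KL by (intro Basilica.centralizer_mod_subgroup N) simp
  ultimately have "inv\<^bsub>Basilica\<^esub> (inv\<^bsub>Basilica\<^esub> ?K) \<in> centralizer_mod Basilica {?L} N"
    by (rule subgroup.m_inv_closed[rotated])
  then have "commutator Basilica ?K ?L \<in> N"
    using Basilica.inv_inv[OF KL(1)] by (simp add: centralizer_mod_def)
  then show ?thesis
    unfolding commutator_graft[OF KL] graft_mem_iff[OF N] .
qed

text \<open>
  Starting from a vertex \<open>v\<close> that is moved by an element of \<open>N\<close>, the stabilizer of level \<open>length v + 9\<close> is found
  in \<open>N\<close>: length of \<open>v\<close> steps to reach \<open>[B', B']\<close>, three further steps to reach the relators, and six levels for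
  the normal form.
\<close>

lemma normal_contains_level_stabilizer:
  assumes N: "N \<lhd> Basilica" and "N \<noteq> {id}"
  shows "\<exists>n. level_stabilizer second_basilica n \<subseteq> N"
proof -
  have "id \<in> N" using subgroup.one_closed[OF normal_imp_subgroup[OF N]] by simp
  with assms(2) obtain g where "g \<in> N" "g \<noteq> id" by blast
  then obtain v where g: "g \<in> N" "g v \<noteq> v" by (auto simp: fun_eq_iff)
  let ?R = "coordinate_subgroup"
  let ?C = "(?R ^^ length v) N"
  have C: "?C \<lhd> Basilica" by (rule coordinate_power_normal[OF N])
  have M: "?R (?R ?C) \<lhd> Basilica" by (intro coordinate_subgroup_normal C)
  have central: "second_basilica \<subseteq> centralizer_mod Basilica basilica_derived (?R (?R ?C))"
    by (rule derived_commutators_coordinate[OF C derived_commutator_coordinate_power[OF N g]])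
  have comm: "commutator Basilica m x \<in> ?R (?R ?C)" if "m \<in> basilica_derived" "x \<in> second_basilica" for m x
  proof (rule Basilica.commutator_mem_commute[OF M that(2)])
    show "m \<in> second_basilica" using that(1) normal_subset[OF derived_normal] by blast
    show "commutator Basilica x m \<in> ?R (?R ?C)"
      using subsetD[OF central that(2)] that(1) by (simp add: centralizer_mod_def)
  qed
  have "level_stabilizer second_basilica 6 \<subseteq> ?R (?R (?R ?C))"
    by (rule level_stabilizer_subset_of_relations[OF coordinate_subgroup_normal[OF M]
          coordinate_commutators[OF M comm]])
  then have "level_stabilizer second_basilica 6 \<subseteq> (?R ^^ Suc (Suc (Suc (length v)))) N" by simp
  from level_stabilizer_coordinate_power[OF N this] show ?thesis by blast
qed

section \<open>The congruence subgroup property\<close>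

lemma Basilica_level_transitive:
  "\<exists>g\<in>second_basilica. g (replicate (length w) False) = w"
proof (induction w)
  case Nil
  then show ?case by (intro bexI[OF _ Basilica.one_closed]) simp
next
  case (Cons i w)
  then obtain x where x: "x \<in> second_basilica" "x (replicate (length w) False) = w" by blast
  then obtain y where xy: "wreath x y id \<in> second_basilica" using Basilica_self_replicating by blast
  have "gen_a \<circ> wreath x y id \<in> second_basilica"
    by (intro Basilica.m_closed generators_in_Basilica xy)
  show ?case
  proof (cases i)
    case True
    with x(2) \<open>gen_a \<circ> wreath x y id \<in> second_basilica\<close> show ?thesis
      by (intro bexI[of _ "gen_a \<circ> wreath x y id"]) (simp_all add: gen_a_def)
  next
    case False
    with x(2) xy show ?thesis by (intro bexI[of _ "wreath x y id"]) simp_all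
  qed
qed

lemma infinite_Basilica: "infinite second_basilica"
proof
  assume fin: "finite second_basilica"
  let ?n = "card second_basilica"
  have "{w :: word. length w = ?n} \<subseteq> (\<lambda>g. g (replicate ?n False)) ` second_basilica"
  proof
    fix w :: word assume "w \<in> {w. length w = ?n}"
    then have len: "length w = ?n" by simp
    show "w \<in> (\<lambda>g. g (replicate ?n False)) ` second_basilica"
      using Basilica_level_transitive[of w] unfolding len by (auto intro: rev_image_eqI)
  qed
  then have "card {w :: word. length w = ?n} \<le> ?n"
    using surj_card_le[OF fin] by blast
  moreover have "card {w :: word. length w = ?n} = 2 ^ ?n"
    using card_lists_length_eq[of "UNIV :: bool set" ?n] by simp
  ultimately show False using less_exp[of ?n] by simp
qed

theorem proposition3p5: "congruence_subgroup_property second_basilica"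
  unfolding congruence_subgroup_property_def
proof (intro allI impI, elim conjE)
  fix H assume H: "subgroup H Basilica" and fin: "finite (rcosets\<^bsub>Basilica\<^esub> H)"
  obtain N where "N \<lhd> Basilica" "N \<subseteq> H" "N \<noteq> {id}"
    using Basilica.finite_index_normal_core[OF H fin infinite_Basilica] by blast
  then show "\<exists>n. level_stabilizer second_basilica n \<subseteq> H"
    using normal_contains_level_stabilizer by (meson subset_trans)
qed

end
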